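(* Let $r_0=\lceil 7\ln n\rceil$ and let $T$ be a tree chosen uniformly at random among all trees on the vertex set $[n]$. Then with probability $1-o(1)$ as $n\to\infty$, for every pair of paths $P,P'$ in $T$, each of length $r_0$, which share at most one vertex, the checks of $P$ and $P'$ (each taken from its designated starting vertex) are different.
   Context: For a path $P=(u_0,u_1,\dots,u_r)$ in a tree $T$ with designated starting vertex $u_0$, its check is the binary sequence $b_0b_1\cdots b_r$ where $b_i=0$ if $u_i$ is adjacent to a vertex of degree one in $T$, and $b_i=1$ otherwise. *)

theory Defs
  imports "HOL-Probability.Probability"
begin

(* A simple graph is given by a vertex set V and a set E of edges, each edge being a
   two-element subset of V; hence {u, v} \<in> E forces u \<noteq> v. *)
definition simple_graph :: "'a set \<Rightarrow> 'a set set \<Rightarrow> bool" where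
  "simple_graph V E \<longleftrightarrow> (\<forall>e\<in>E. e \<subseteq> V \<and> card e = 2)"

definition neighbours :: "'a set set \<Rightarrow> 'a \<Rightarrow> 'a set" where
  "neighbours E v = {w. {v, w} \<in> E}"

definition degree :: "'a set set \<Rightarrow> 'a \<Rightarrow> nat" where
  "degree E v = card (neighbours E v)"

(* Paths are sequences of pairwise distinct vertices, so they carry a starting vertex, and a
   path and its reversal are different sequences. *)
definition is_path :: "'a set \<Rightarrow> 'a set set \<Rightarrow> 'a list \<Rightarrow> bool" where
  "is_path V E p \<longleftrightarrow>
     p \<noteq> [] \<and> set p \<subseteq> V \<and> distinct p \<and> successively (\<lambda>u v. {u, v} \<in> E) p"

(* Number of edges, not of vertices. *)
definition path_length :: "'a list \<Rightarrow> nat" where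
  "path_length p = length p - 1"

definition is_cycle :: "'a set set \<Rightarrow> 'a list \<Rightarrow> bool" where
  "is_cycle E c \<longleftrightarrow>
     length c \<ge> 3 \<and> distinct c \<and> successively (\<lambda>u v. {u, v} \<in> E) c \<and> {last c, hd c} \<in> E"

definition connected_graph :: "'a set \<Rightarrow> 'a set set \<Rightarrow> bool" where
  "connected_graph V E \<longleftrightarrow>
     V \<noteq> {} \<and> (\<forall>u\<in>V. \<forall>v\<in>V. \<exists>p. is_path V E p \<and> hd p = u \<and> last p = v)"

definition is_tree :: "'a set \<Rightarrow> 'a set set \<Rightarrow> bool" where
  "is_tree V E \<longleftrightarrow> simple_graph V E \<and> connected_graph V E \<and> \<not> (\<exists>c. is_cycle E c)"

(* The vertex set is fixed, so a labelled tree is identified with its edge set. *)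
definition labelled_trees :: "nat \<Rightarrow> nat set set set" where
  "labelled_trees n = {E. is_tree {1..n} E}"

definition adjacent_to_leaf :: "'a set set \<Rightarrow> 'a \<Rightarrow> bool" where
  "adjacent_to_leaf E u \<longleftrightarrow> (\<exists>w\<in>neighbours E u. degree E w = 1)"

definition path_check :: "'a set set \<Rightarrow> 'a list \<Rightarrow> nat list" where
  "path_check E p = map (\<lambda>u. if adjacent_to_leaf E u then 0 else 1) p"

definition checks_distinct :: "nat \<Rightarrow> 'a set \<Rightarrow> 'a set set \<Rightarrow> bool" where
  "checks_distinct r V E \<longleftrightarrow>
     (\<forall>p q. is_path V E p \<and> is_path V E q \<and> path_length p = r \<and> path_length q = r \<and>
        card (set p \<inter> set q) \<le> 1 \<longrightarrow> path_check E p \<noteq> path_check E q)"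

(* The next two facts ensure that pmf_of_set (labelled_trees n) is the uniform distribution on
   the labelled trees for every n \<ge> 1. *)
lemma finite_labelled_trees: "finite (labelled_trees n)"
proof (rule finite_subset)
  show "labelled_trees n \<subseteq> Pow (Pow {1..n})"
    by (auto simp: labelled_trees_def is_tree_def simple_graph_def)
qed simp

lemma labelled_trees_nonempty:
  assumes "n \<ge> 1"
  shows "labelled_trees n \<noteq> {}"
proof -
  define E where "E = (\<lambda>v. {1, v}) ` {2..n}"
  have edge: "{u, v} \<in> E \<longleftrightarrow> (u = 1 \<and> v \<in> {2..n}) \<or> (v = 1 \<and> u \<in> {2..n})" for u v
    unfolding E_def image_iff doubleton_eq_iff by blast
  have simple: "simple_graph {1..n} E"
    using assms by (auto simp: simple_graph_def E_def)
  have connected: "connected_graph {1..n} E"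
    unfolding connected_graph_def
  proof (intro conjI ballI)
    show "{1..n} \<noteq> {}" using assms by auto
  next
    fix u v assume uv: "u \<in> {1..n}" "v \<in> {1..n}"
    define p where "p = (if u = v then [u] else if u = 1 \<or> v = 1 then [u, v] else [u, 1, v])"
    have "is_path {1..n} E p \<and> hd p = u \<and> last p = v"
      using uv assms by (auto simp: p_def is_path_def edge)
    then show "\<exists>p. is_path {1..n} E p \<and> hd p = u \<and> last p = v" by blast
  qed
  have acyclic: "\<not> is_cycle E c" for c
  proof
    assume c: "is_cycle E c"
    then have "length c \<ge> Suc (Suc (Suc 0))"
      by (simp add: is_cycle_def)
    then obtain x y z zs where c_eq: "c = x # y # z # zs"
      by (auto simp: Suc_le_length_iff)
    have "{x, y} \<in> E" "{y, z} \<in> E" and last: "{last (z # zs), x} \<in> E"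
      and dist: "distinct c"
      using c by (auto simp: is_cycle_def c_eq)
    then have "y = 1" and "x \<noteq> 1"
      unfolding edge c_eq by force+
    then have "last (z # zs) = 1" using last unfolding edge by blast
    moreover have "last (z # zs) \<in> set (z # zs)" by (rule last_in_set) simp
    moreover have "y \<notin> set (z # zs)" using dist by (simp add: c_eq)
    ultimately show False using \<open>y = 1\<close> by metis
  qed
  have "E \<in> labelled_trees n"
    using simple connected acyclic by (simp add: labelled_trees_def is_tree_def)
  then show ?thesis by blast
qed

end

theory Submission
  imports Defs "HOL-Real_Asymp.Real_Asymp"
begin

text \<open>
  First moment method. Root a tree at the vertex 1 and let par be its parent map. A path runs up to an apex and then
  down again, so the tree is recovered from the two paths, the positions of their apexes and the restriction \<open>g\<close> of par
  to the set \<open>D\<close> of the vertices other than the root that are not non-apex vertices of the paths. The paths share at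
  most one vertex, which makes their sets of non-apex vertices disjoint; hence \<open>D\<close> has \<open>n - 1 - 2 r\<close> elements whether
  or not the paths meet. Away from the ends, the apexes and the shared vertex, the check of a path vertex \<open>x\<close> is 0 iff
  some \<open>w\<close> off the paths has \<open>g w = x\<close> and no preimage under \<open>g\<close>.

  Now forget that \<open>g\<close> comes from a tree. Assigning the elements of \<open>D\<close> to the \<open>n\<close> values behaves like \<open>n\<close> independent
  Poisson variables of mean 1, up to a factor of order \<open>sqrt n\<close>. A path vertex then has check 1 with probability
  \<open>u = exp (- exp (- 1))\<close>, and two checks agree with probability \<open>u\<^sup>2 + (1 - u)\<^sup>2 < 0.58\<close>. Against the \<open>n ^ (n - 2)\<close>
  labelled trees, ignoring acyclicity costs a factor \<open>n\<close> and the choice of the paths a factor \<open>n\<^sup>2\<close>, so the expected number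
  of bad pairs is of order \<open>n ^ 3.5 * (ln n)\<^sup>2 * 0.58 ^ (7 ln n)\<close>, and \<open>0.58 ^ 7 < exp (- 3.5)\<close>.
\<close>

section \<open>Counting maps by their fibres\<close>

lemma sum_Pow_card:
  fixes \<phi> :: "nat \<Rightarrow> 'b :: comm_semiring_1"
  assumes "finite A"
  shows "(\<Sum>U\<in>Pow A. \<phi> (card U)) = (\<Sum>j\<le>card A. of_nat (card A choose j) * \<phi> j)"
proof -
  have "(\<Sum>U\<in>Pow A. \<phi> (card U)) = (\<Sum>j\<le>card A. \<Sum>U\<in>{U\<in>Pow A. card U = j}. \<phi> (card U))"
    using assms by (intro sum.group[symmetric]) (auto intro: card_mono)
  also have "\<dots> = (\<Sum>j\<le>card A. of_nat (card A choose j) * \<phi> j)"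
  proof (rule sum.cong[OF refl])
    fix j
    have "(\<Sum>U\<in>{U\<in>Pow A. card U = j}. \<phi> (card U)) = (\<Sum>U\<in>{U\<in>Pow A. card U = j}. \<phi> j)"
      by (rule sum.cong) auto
    then show "(\<Sum>U\<in>{U\<in>Pow A. card U = j}. \<phi> (card U)) = of_nat (card A choose j) * \<phi> j"
      using n_subsets[OF assms, of j] by simp
  qed
  finally show ?thesis .
qed

text \<open>The factorial of the complement cancels against the binomial coefficient, so this weight
  turns a sum over subsets into a truncated exponential generating function.\<close>

lemma sum_Pow_card_fact:
  fixes \<phi> :: "nat \<Rightarrow> real"
  assumes "finite A"
  shows "(\<Sum>U\<in>Pow A. \<phi> (card U) * fact (card A - card U)) = fact (card A) * (\<Sum>j\<le>card A. \<phi> j / fact j)"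
  unfolding sum_Pow_card[OF assms, of "\<lambda>j. \<phi> j * fact (card A - j)"] sum_distrib_left
  by (rule sum.cong) (auto simp: binomial_fact field_simps)

lemma sum_power_div_fact_le_exp:
  fixes x :: real
  assumes "x \<ge> 0"
  shows "(\<Sum>j\<le>N. x ^ j / fact j) \<le> exp x"
proof -
  have "(\<Sum>j\<le>N. x ^ j / fact j) \<le> (\<Sum>j. x ^ j / fact j)"
    using assms summable_exp_generic[of x]
    by (intro sum_le_suminf) (auto simp: divide_inverse mult.commute)
  then show ?thesis by (simp add: exp_def divide_inverse mult.commute)
qed

lemma sum_power_div_fact_le_exp_minus_1:
  fixes x :: real
  assumes "x \<ge> 0"
  shows "(\<Sum>j\<le>N. (if j = 0 then 0 else x ^ j) / fact j) \<le> exp x - 1"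
proof -
  have "(\<Sum>j\<le>N. (if j = 0 then 0 else x ^ j) / fact j) = (\<Sum>j\<le>N. x ^ j / fact j - (if j = 0 then 1 else 0))"
    by (rule sum.cong) auto
  also have "\<dots> = (\<Sum>j\<le>N. x ^ j / fact j) - 1"
    by (simp add: sum_subtractf)
  finally show ?thesis using sum_power_div_fact_le_exp[OF assms, of N] by simp
qed

text \<open>Split off the fibre \<open>U\<close> of \<open>y\<close>: it is nonempty if
  \<open>y\<close> must be hit, and \<open>f\<close> is recovered from \<open>U\<close> and its
  restriction to \<open>L - U\<close>.\<close>

lemma card_PiE_covering_insert_le:
  assumes "finite L" "finite B" "y \<notin> B"
  shows "card {f \<in> L \<rightarrow>\<^sub>E insert y B. S \<subseteq> f ` L}
     \<le> (\<Sum>U\<in>{U \<in> Pow L. y \<in> S \<longrightarrow> U \<noteq> {}}. card {f \<in> (L - U) \<rightarrow>\<^sub>E B. S - {y} \<subseteq> f ` (L - U)})"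
proof -
  let ?Us = "{U \<in> Pow L. y \<in> S \<longrightarrow> U \<noteq> {}}"
  let ?F = "\<lambda>U. {f \<in> (L - U) \<rightarrow>\<^sub>E B. S - {y} \<subseteq> f ` (L - U)}"
  let ?h = "\<lambda>f. let U = {w \<in> L. f w = y} in (U, restrict f (L - U))"
  have fin: "finite (?F U)" for U
    using assms by (intro finite_subset[OF _ finite_PiE[of "L - U" "\<lambda>_. B"]]) auto
  have "card {f \<in> L \<rightarrow>\<^sub>E insert y B. S \<subseteq> f ` L} \<le> card (SIGMA U:?Us. ?F U)"
  proof (rule card_inj_on_le[where f = ?h])
    show "inj_on ?h {f \<in> L \<rightarrow>\<^sub>E insert y B. S \<subseteq> f ` L}"
    proof (rule inj_onI)
      fix f g assume f: "f \<in> {f \<in> L \<rightarrow>\<^sub>E insert y B. S \<subseteq> f ` L}" and g: "g \<in> {f \<in> L \<rightarrow>\<^sub>E insert y B. S \<subseteq> f ` L}"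
        and eq: "?h f = ?h g"
      have U: "{w \<in> L. f w = y} = {w \<in> L. g w = y}"
        and r: "restrict f (L - {w \<in> L. f w = y}) = restrict g (L - {w \<in> L. g w = y})"
        using eq by (auto simp: Let_def)
      show "f = g"
      proof
        fix w show "f w = g w"
        proof (cases "w \<in> L")
          case True
          show ?thesis
          proof (cases "f w = y")
            case True
            with \<open>w \<in> L\<close> U have "g w = y" by blast
            with True show ?thesis by simp
          next
            case False
            with \<open>w \<in> L\<close> U have "g w \<noteq> y" by auto
            with False \<open>w \<in> L\<close> show ?thesis using fun_cong[OF r, of w] by simp
          qed
        qed (use f g in \<open>auto simp: PiE_def extensional_def\<close>)
      qed
    qed
    show "?h ` {f \<in> L \<rightarrow>\<^sub>E insert y B. S \<subseteq> f ` L} \<subseteq> (SIGMA U:?Us. ?F U)"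
    proof (rule image_subsetI)
      fix f assume f: "f \<in> {f \<in> L \<rightarrow>\<^sub>E insert y B. S \<subseteq> f ` L}"
      let ?U = "{w \<in> L. f w = y}"
      have "y \<in> S \<longrightarrow> ?U \<noteq> {}" using f by (auto simp: subset_iff image_iff)
      moreover have "restrict f (L - ?U) \<in> ?F ?U"
      proof -
        have "restrict f (L - ?U) \<in> (L - ?U) \<rightarrow>\<^sub>E B" using f by (auto simp: PiE_iff)
        moreover have "S - {y} \<subseteq> restrict f (L - ?U) ` (L - ?U)"
        proof
          fix s assume s: "s \<in> S - {y}"
          then obtain w where "w \<in> L" "f w = s" using f by auto
          with s have "w \<in> L - ?U" by auto
          then show "s \<in> restrict f (L - ?U) ` (L - ?U)" using \<open>f w = s\<close> by auto
        qed
        ultimately show ?thesis by blast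
      qed
      ultimately show "?h f \<in> (SIGMA U:?Us. ?F U)" by (auto simp: Let_def)
    qed
    show "finite (SIGMA U:?Us. ?F U)" using assms fin by (intro finite_SigmaI) auto
  qed
  also have "\<dots> = (\<Sum>U\<in>?Us. card (?F U))"
    using assms fin by (intro card_SigmaI) auto
  finally show ?thesis .
qed

lemma sum_Pow_Pow_swap:
  assumes "finite D"
  shows "(\<Sum>L\<in>Pow D. \<Sum>U\<in>Pow L. f U (L - U)) = (\<Sum>U\<in>Pow D. \<Sum>L\<in>Pow (D - U). f U L)"
proof -
  have fin: "finite L" if "L \<in> Pow D" for L
    using that assms by (auto intro: finite_subset)
  have "(\<Sum>L\<in>Pow D. \<Sum>U\<in>Pow L. f U (L - U)) = (\<Sum>(L,U)\<in>(SIGMA L:Pow D. Pow L). f U (L - U))"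
    using assms fin by (subst sum.Sigma) auto
  also have "\<dots> = (\<Sum>(U,L)\<in>(SIGMA U:Pow D. Pow (D - U)). f U L)"
    by (rule sum.reindex_bij_witness[where j = "\<lambda>(L,U). (U, L - U)" and i = "\<lambda>(U,L). (L \<union> U, U)"]) auto
  also have "\<dots> = (\<Sum>U\<in>Pow D. \<Sum>L\<in>Pow (D - U). f U L)"
    using assms fin by (subst sum.Sigma) auto
  finally show ?thesis .
qed

text \<open>With the factorial weight, the left side is \<open>fact (card D)\<close> times a
  truncated exponential generating function in \<open>x\<close>, which is bounded one value at a
  time: a value in \<open>S\<close> has a nonempty fibre and contributes at most
  \<open>exp x - 1\<close>, any other value at most \<open>exp x\<close>. The factorial left over
  for \<open>D - L\<close> allows several such sums to be chained on disjoint parts of one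
  domain.\<close>

lemma sum_card_covering_maps_le:
  fixes x :: real
  assumes "finite B" "finite D" "S \<subseteq> B" "x \<ge> 0"
  shows "(\<Sum>L\<in>Pow D. x ^ card L * fact (card D - card L) * card {f \<in> L \<rightarrow>\<^sub>E B. S \<subseteq> f ` L})
     \<le> fact (card D) * (exp x ^ card (B - S) * (exp x - 1) ^ card S)"
  using assms(1-3)
proof (induction B arbitrary: D S rule: finite_induct)
  case empty
  have "(\<Sum>L\<in>Pow D. x ^ card L * fact (card D - card L) * card {f \<in> L \<rightarrow>\<^sub>E {}. S \<subseteq> f ` L})
      = (\<Sum>L\<in>Pow D. if L = {} then fact (card D) else 0)"
  proof (rule sum.cong[OF refl])
    fix L :: "'b set"
    show "x ^ card L * fact (card D - card L) * card {f \<in> L \<rightarrow>\<^sub>E {}. S \<subseteq> f ` L} = (if L = {} then fact (card D) else 0)"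
    proof (cases "L = {}")
      case True
      then have "{f \<in> L \<rightarrow>\<^sub>E {}. S \<subseteq> f ` L} = {\<lambda>_. undefined}" using empty by auto
      then show ?thesis using True by simp
    next
      case False
      then have "L \<rightarrow>\<^sub>E {} = ({} :: ('b \<Rightarrow> 'a) set)" by (auto simp: PiE_eq_empty_iff)
      then show ?thesis using False by simp
    qed
  qed
  also have "\<dots> = fact (card D)" using empty by (subst sum.delta) auto
  finally show ?case using empty by simp
next
  case (insert y B)
  \<comment> \<open>\<open>c\<close> weights the fibre of \<open>y\<close> by its size and excludes
    the empty fibre if \<open>y\<close> must be hit; \<open>e\<close> bounds its generating
    function. \<open>K\<close> is the bound that induction gives for the remaining values.\<close>
  define c where "c = (\<lambda>j::nat. if y \<in> S \<and> j = 0 then 0 else x ^ j)"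
  define e where "e = (if y \<in> S then exp x - 1 else exp x)"
  define K where "K = exp x ^ card (B - (S - {y})) * (exp x - 1) ^ card (S - {y})"
  have c: "(\<Sum>j\<le>N. c j / fact j) \<le> e" for N
    using sum_power_div_fact_le_exp[OF assms(4), of N] sum_power_div_fact_le_exp_minus_1[OF assms(4), of N]
    by (auto simp: c_def e_def)
  have c0: "c j \<ge> 0" for j using assms(4) by (auto simp: c_def)
  have K0: "K \<ge> 0" using assms(4) by (auto simp: K_def)
  have fS: "finite S" using insert.hyps insert.prems by (auto intro: finite_subset)
  have eK: "e * K = exp x ^ card (insert y B - S) * (exp x - 1) ^ card S"
  proof (cases "y \<in> S")
    case True
    have "insert y B - S = B - (S - {y})" using True insert.hyps by auto
    moreover have "(exp x - 1) ^ card S = (exp x - 1) * (exp x - 1) ^ card (S - {y})"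
      by (subst card_Suc_Diff1[OF fS True, symmetric]) simp
    ultimately show ?thesis using True by (simp add: e_def K_def)
  next
    case False
    have "insert y B - S = insert y (B - S)" "S - {y} = S" using False by auto
    moreover have "y \<notin> B - S" "finite (B - S)" using insert.hyps by auto
    ultimately show ?thesis using False by (simp add: e_def K_def)
  qed
  let ?n = "\<lambda>L. real (card {f \<in> L \<rightarrow>\<^sub>E B. S - {y} \<subseteq> f ` L})"
  have fL: "finite L" if "L \<subseteq> D" for L using that insert.prems by (auto intro: finite_subset)
  have "(\<Sum>L\<in>Pow D. x ^ card L * fact (card D - card L) * card {f \<in> L \<rightarrow>\<^sub>E insert y B. S \<subseteq> f ` L})
      \<le> (\<Sum>L\<in>Pow D. \<Sum>U\<in>Pow L. c (card U) * x ^ card (L - U) * fact (card D - card U - card (L - U)) * ?n (L - U))"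
  proof (rule sum_mono)
    fix L assume L: "L \<in> Pow D"
    then have "finite L" using fL by auto
    have "real (card {f \<in> L \<rightarrow>\<^sub>E insert y B. S \<subseteq> f ` L}) \<le> (\<Sum>U\<in>{U \<in> Pow L. y \<in> S \<longrightarrow> U \<noteq> {}}. ?n (L - U))"
      using card_PiE_covering_insert_le[OF \<open>finite L\<close> insert(1,2), of S] by (simp flip: of_nat_sum)
    then have "x ^ card L * fact (card D - card L) * real (card {f \<in> L \<rightarrow>\<^sub>E insert y B. S \<subseteq> f ` L})
       \<le> x ^ card L * fact (card D - card L) * (\<Sum>U\<in>{U \<in> Pow L. y \<in> S \<longrightarrow> U \<noteq> {}}. ?n (L - U))"
      using assms(4) by (intro mult_left_mono) auto
    also have "\<dots> = (\<Sum>U\<in>{U \<in> Pow L. y \<in> S \<longrightarrow> U \<noteq> {}}. x ^ card L * fact (card D - card L) * ?n (L - U))"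
      by (simp add: sum_distrib_left)
    also have "\<dots> = (\<Sum>U\<in>Pow L. if y \<in> S \<longrightarrow> U \<noteq> {} then x ^ card L * fact (card D - card L) * ?n (L - U) else 0)"
      using \<open>finite L\<close> by (intro sum.inter_filter) auto
    also have "\<dots> = (\<Sum>U\<in>Pow L. c (card U) * x ^ card (L - U) * fact (card D - card U - card (L - U)) * ?n (L - U))"
    proof (rule sum.cong[OF refl])
      fix U assume U: "U \<in> Pow L"
      then have "finite U" "card U \<le> card L" "card (L - U) = card L - card U"
        using \<open>finite L\<close> by (auto intro: finite_subset card_mono card_Diff_subset)
      then show "(if y \<in> S \<longrightarrow> U \<noteq> {} then x ^ card L * fact (card D - card L) * ?n (L - U) else 0)
        = c (card U) * x ^ card (L - U) * fact (card D - card U - card (L - U)) * ?n (L - U)"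
        by (auto simp: c_def simp flip: power_add)
    qed
    finally show "x ^ card L * fact (card D - card L) * card {f \<in> L \<rightarrow>\<^sub>E insert y B. S \<subseteq> f ` L} \<le> \<dots>" .
  qed
  \<comment> \<open>Choosing the fibre \<open>U\<close> first and the rest of the domain inside
    \<open>D - U\<close> makes the induction hypothesis applicable to \<open>D - U\<close>.\<close>
  also have "\<dots> = (\<Sum>U\<in>Pow D. \<Sum>L\<in>Pow (D - U). c (card U) * x ^ card L * fact (card D - card U - card L) * ?n L)"
    by (rule sum_Pow_Pow_swap[OF insert.prems(1)])
  also have "\<dots> \<le> (\<Sum>U\<in>Pow D. c (card U) * (fact (card D - card U) * K))"
  proof (rule sum_mono)
    fix U assume U: "U \<in> Pow D"
    then have cD: "card (D - U) = card D - card U" using fL by (intro card_Diff_subset) auto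
    have "(\<Sum>L\<in>Pow (D - U). x ^ card L * fact (card (D - U) - card L) * ?n L) \<le> fact (card (D - U)) * K"
      unfolding K_def using insert.prems by (intro insert.IH) auto
    then have "c (card U) * (\<Sum>L\<in>Pow (D - U). x ^ card L * fact (card (D - U) - card L) * ?n L) \<le> c (card U) * (fact (card (D - U)) * K)"
      using c0 by (intro mult_left_mono) auto
    then show "(\<Sum>L\<in>Pow (D - U). c (card U) * x ^ card L * fact (card D - card U - card L) * ?n L) \<le> c (card U) * (fact (card D - card U) * K)"
      by (simp add: cD sum_distrib_left mult.assoc)
  qed
  also have "\<dots> = K * (\<Sum>U\<in>Pow D. c (card U) * fact (card D - card U))"
    by (simp add: sum_distrib_left mult_ac)
  also have "\<dots> = K * (fact (card D) * (\<Sum>j\<le>card D. c j / fact j))"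
    by (simp add: sum_Pow_card_fact[OF insert.prems(1)])
  also have "\<dots> \<le> K * (fact (card D) * e)"
    using c K0 by (intro mult_left_mono) auto
  also have "\<dots> = fact (card D) * (e * K)" by simp
  finally show ?case unfolding eK .
qed

section \<open>Maps under which paired values behave alike\<close>

lemma sum_Pow_power_card:
  fixes a :: real
  assumes "finite I"
  shows "(\<Sum>Z\<in>Pow I. a ^ card Z) = (1 + a) ^ card I"
  using prod_add[OF assms, of "\<lambda>_. a" "\<lambda>_. 1"] by (simp add: add.commute)

text \<open>\<open>D0\<close> is smaller than \<open>D\<close> because the apex of a path may lie in \<open>D\<close> without preimage under \<open>g\<close>,
  although it is not a leaf: its children are path vertices, which are not in \<open>D\<close>.\<close>

definition has_leaf_preimage :: "'a set \<Rightarrow> 'a set \<Rightarrow> ('a \<Rightarrow> 'a) \<Rightarrow> 'a \<Rightarrow> bool" where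
  "has_leaf_preimage D D0 g x \<longleftrightarrow> (\<exists>w\<in>D0. g w = x \<and> w \<notin> g ` D)"

text \<open>This is \<open>u\<^sup>2 + (1 - u)\<^sup>2\<close> in the form in which the counting
  produces it: \<open>exp (- 2 * exp (- 1))\<close> is the weight of two missed values, and the
  bracket adds the case that both are hit by leaf preimages.\<close>

definition match_rate :: real where
  "match_rate = exp (- 2 * exp (- 1)) * (1 + (exp (exp (- 1)) - 1)\<^sup>2)"

text \<open>The exponent is fine enough for the final estimate because \<open>7 * 51 / 100\<close>
  exceeds \<open>7 / 2\<close>. Bounds on \<open>exp 1\<close> place \<open>u\<close> between
  \<open>1 / 2\<close> and \<open>7 / 10\<close>, where the rate is at most
  \<open>29 / 50\<close>.\<close>

lemma match_rate_bounds: "0 < match_rate" "match_rate \<le> exp (- 51 / 100)"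
proof -
  show "0 < match_rate" by (simp add: match_rate_def add_pos_nonneg)
  define y u where "y = exp (- 1 :: real)" and "u = exp (- y)"
  have "1 + 1 \<le> exp (1 :: real)" by (rule exp_ge_add_one_self)
  then have "y \<le> 1 / 2" by (simp add: y_def exp_minus field_simps)
  have "exp (1 :: real) \<le> 68 / 25" using e_less_272 by simp
  then have y: "25 / 68 \<le> y" by (simp add: y_def exp_minus field_simps)
  have u: "1 - y \<le> u" using exp_ge_add_one_self[of "- y"] by (simp add: u_def)
  have "(25 / 68)\<^sup>2 \<le> y\<^sup>2" using y by (intro power_mono) auto
  then have "10 / 7 \<le> 1 + y + y\<^sup>2 / 2" using y by (simp add: power2_eq_square)
  also have "\<dots> \<le> exp y" using y by (intro exp_lower_Taylor_quadratic) auto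
  finally have "u \<le> 7 / 10" by (simp add: u_def exp_minus field_simps)
  \<comment> \<open>Twice this product is
    \<open>u\<^sup>2 + (1 - u)\<^sup>2 - 29 / 50\<close>.\<close>
  then have "(u - 3 / 10) * (u - 7 / 10) \<le> 0"
    using u \<open>y \<le> 1 / 2\<close> by (intro mult_nonneg_nonpos) auto
  moreover have "match_rate = u\<^sup>2 + (1 - u)\<^sup>2"
  proof -
    have "exp y * u = 1" by (simp add: u_def flip: exp_add)
    moreover have "exp (- 2 * y) = u\<^sup>2" by (simp add: u_def power2_eq_square flip: exp_add)
    ultimately have "match_rate = u\<^sup>2 + (exp y * u - u)\<^sup>2"
      by (simp add: match_rate_def y_def[symmetric] algebra_simps power2_eq_square)
    then show ?thesis using \<open>exp y * u = 1\<close> by simp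
  qed
  ultimately have "match_rate \<le> 29 / 50" by (simp add: algebra_simps power2_eq_square)
  \<comment> \<open>After squaring, the right side is \<open>exp (- 1) * exp (- 1 / 50)\<close>, so
    the rational lower bound for \<open>y\<close> can be used again.\<close>
  also have "29 / 50 \<le> exp (- 51 / 100 :: real)"
  proof (rule power2_le_imp_le)
    have "(29 / 50)\<^sup>2 \<le> 25 / 68 * (1 + - 1 / 50 :: real)" by (simp add: power2_eq_square)
    also have "\<dots> \<le> y * exp (- 1 / 50)"
      using y exp_ge_add_one_self[of "- 1 / 50"] by (intro mult_mono) auto
    also have "\<dots> = (exp (- 51 / 100))\<^sup>2" by (simp add: y_def power2_eq_square flip: exp_add)
    finally show "(29 / 50)\<^sup>2 \<le> (exp (- 51 / 100 :: real))\<^sup>2" .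
  qed simp
  finally show "match_rate \<le> exp (- 51 / 100)" .
qed

text \<open>Split \<open>g\<close> according to \<open>L\<close>, the leaf preimages of the paired values, \<open>W\<close>, their other preimages, and the rest.
  The rest must hit \<open>W \<inter> D0\<close> and avoid \<open>L\<close>; each of the three parts is summed by \<open>sum_card_covering_maps_le\<close>,
  with \<open>x = exp (- 1)\<close>, \<open>\<kappa>\<close> and \<open>1\<close> respectively.\<close>

lemma card_symmetric_maps_le:
  fixes u v :: "'i \<Rightarrow> 'a"
  assumes V: "finite V" "D \<subseteq> V" "D0 \<subseteq> D" and I: "finite I"
    and inj: "inj_on u I" "inj_on v I" and disj: "u ` I \<inter> v ` I = {}"
    and sub: "u ` I \<union> v ` I \<subseteq> V - D"
  defines "\<kappa> \<equiv> 1 - exp (- 1 :: real)"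
  shows "real (card {g \<in> D \<rightarrow>\<^sub>E V. \<forall>i\<in>I. has_leaf_preimage D D0 g (u i) \<longleftrightarrow> has_leaf_preimage D D0 g (v i)}) * \<kappa> ^ card (D - D0)
     \<le> fact (card D) * exp (real (card V)) * match_rate ^ card I"
proof -
  define y where "y = exp (- 1 :: real)"
  define X where "X = (\<lambda>Z. u ` Z \<union> v ` Z)"
  define Q where "Q = {g \<in> D \<rightarrow>\<^sub>E V. \<forall>i\<in>I. has_leaf_preimage D D0 g (u i) \<longleftrightarrow> has_leaf_preimage D D0 g (v i)}"
  define F1 where "F1 = (\<lambda>(L :: 'a set) Z. {f \<in> L \<rightarrow>\<^sub>E X Z. X Z \<subseteq> f ` L})"
  define F2 where "F2 = (\<lambda>(W :: 'a set). W \<rightarrow>\<^sub>E X I)"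
  define F3 where "F3 = (\<lambda>L W. {f \<in> (D - L - W) \<rightarrow>\<^sub>E (V - X I - L). W \<inter> D0 \<subseteq> f ` (D - L - W)})"
  define m n d \<delta> where "m = card (X I)" and "n = card V" and "d = card D" and "\<delta> = card (D - D0)"
  have fD: "finite D" using V finite_subset by blast
  have XI: "X I \<subseteq> V" "X I \<inter> D = {}" using sub by (auto simp: X_def)
  have finZ: "finite Z" if "Z \<subseteq> I" for Z using that I finite_subset by blast
  have finX: "finite (X Z)" if "Z \<subseteq> I" for Z using finZ[OF that] by (simp add: X_def)
  have cardX: "card (X Z) = 2 * card Z" if "Z \<subseteq> I" for Z
  proof -
    have "card (X Z) = card (u ` Z) + card (v ` Z)"
      unfolding X_def using finZ[OF that] disj that by (intro card_Un_disjoint) auto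
    then show ?thesis using inj that by (simp add: card_image inj_on_subset)
  qed
  have finL: "finite L" if "L \<subseteq> D" for L using that fD finite_subset by blast
  have f1: "finite (F1 L Z)" if "L \<subseteq> D" "Z \<subseteq> I" for L Z
    unfolding F1_def using finL[OF that(1)] finX[OF that(2)]
    by (intro finite_subset[OF _ finite_PiE[of L "\<lambda>_. X Z"]]) auto
  have f2: "finite (F2 W)" if "W \<subseteq> D" for W
    unfolding F2_def using finL[OF that] finX[of I] by (intro finite_PiE) auto
  have f3: "finite (F3 L W)" for L W
    unfolding F3_def using fD V
    by (intro finite_subset[OF _ finite_PiE[of "D - L - W" "\<lambda>_. V - X I - L"]]) auto
  have y: "0 < y" "y < 1" by (auto simp: y_def)
  have \<kappa>: "0 < \<kappa>" "\<kappa> < 1" "\<kappa> = 1 - y" by (auto simp: \<kappa>_def y_def)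

  let ?A = "SIGMA L:Pow D. SIGMA W:Pow (D - L). SIGMA Z:Pow I. F1 L Z \<times> F2 W \<times> F3 L W"
  define lf where "lf = (\<lambda>g. {w \<in> D0. g w \<in> X I \<and> w \<notin> g ` D})"
  define nl where "nl = (\<lambda>g. {w \<in> D. g w \<in> X I} - lf g)"
  \<comment> \<open>Testing \<open>u i\<close> alone suffices: for \<open>g\<close> in
    \<open>Q\<close>, a leaf preimage hits \<open>v i\<close> exactly when one hits
    \<open>u i\<close>.\<close>
  define hz where "hz = (\<lambda>g. {i \<in> I. u i \<in> g ` lf g})"
  let ?h = "\<lambda>g. (lf g, nl g, hz g, restrict g (lf g), restrict g (nl g), restrict g (D - lf g - nl g))"
  have "card Q \<le> card ?A"
  proof (rule card_inj_on_le[where f = ?h])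
    show "finite ?A"
      using fD I f1 f2 f3 by (intro finite_SigmaI finite_cartesian_product) (auto intro!: f2)
    show "inj_on ?h Q"
    proof (rule inj_onI)
      fix g g' assume g: "g \<in> Q" "g' \<in> Q" and eq: "?h g = ?h g'"
      have e1: "lf g = lf g'" "nl g = nl g'" using eq by auto
      have e2: "restrict g (lf g) = restrict g' (lf g)" "restrict g (nl g) = restrict g' (nl g)"
        "restrict g (D - lf g - nl g) = restrict g' (D - lf g - nl g)" using eq e1 by auto
      show "g = g'"
      proof
        fix w show "g w = g' w"
        proof (cases "w \<in> D")
          case True
          then consider "w \<in> lf g" | "w \<in> nl g" | "w \<in> D - lf g - nl g" by blast
          then show ?thesis using e2 by cases (metis restrict_apply')+
        next
          case False
          then show ?thesis using g by (auto simp: Q_def PiE_iff extensional_def)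
        qed
      qed
    qed
    show "?h ` Q \<subseteq> ?A"
    proof (rule image_subsetI)
      fix g assume g: "g \<in> Q"
      then have gV: "g w \<in> V" if "w \<in> D" for w using that by (auto simp: Q_def)
      have hit: "has_leaf_preimage D D0 g x \<longleftrightarrow> x \<in> g ` lf g" if "x \<in> X I" for x
        using that by (auto simp: has_leaf_preimage_def lf_def)
      have sym: "u i \<in> g ` lf g \<longleftrightarrow> v i \<in> g ` lf g" if "i \<in> I" for i
        using g that hit[of "u i"] hit[of "v i"] by (auto simp: Q_def X_def)
      have im: "g ` lf g = X (hz g)"
      proof
        show "X (hz g) \<subseteq> g ` lf g" using sym by (auto simp: X_def hz_def)
        show "g ` lf g \<subseteq> X (hz g)"
        proof
          fix x assume x: "x \<in> g ` lf g"
          then obtain i where i: "i \<in> I" "x = u i \<or> x = v i" by (auto simp: lf_def X_def)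
          have "u i \<in> g ` lf g" using i x sym[OF i(1)] by metis
          then have "i \<in> hz g" using i(1) by (simp add: hz_def)
          then show "x \<in> X (hz g)" using i(2) by (auto simp: X_def)
        qed
      qed
      have "lf g \<subseteq> D" "nl g \<subseteq> D - lf g" "hz g \<subseteq> I" using V by (auto simp: lf_def nl_def hz_def)
      moreover have "restrict g (lf g) \<in> F1 (lf g) (hz g)"
        using im by (auto simp: F1_def)
      moreover have "restrict g (nl g) \<in> F2 (nl g)"
        by (auto simp: F2_def nl_def)
      moreover have "restrict g (D - lf g - nl g) \<in> F3 (lf g) (nl g)"
      proof -
        have "g w \<in> V - X I - lf g" if "w \<in> D - lf g - nl g" for w
          using that gV by (auto simp: nl_def lf_def)
        moreover have "w \<in> g ` (D - lf g - nl g)" if "w \<in> nl g \<inter> D0" for w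
        proof -
          have w: "w \<in> D" "w \<in> g ` D" using that by (auto simp: nl_def lf_def)
          then obtain z where z: "z \<in> D" "g z = w" by blast
          then have "g z \<notin> X I" using w XI by auto
          then have "z \<in> D - lf g - nl g" using z by (auto simp: nl_def lf_def)
          then show ?thesis using z by blast
        qed
        ultimately show ?thesis unfolding F3_def by auto
      qed
      ultimately show "?h g \<in> ?A" by blast
    qed
  qed
  also have "card ?A = (\<Sum>L\<in>Pow D. \<Sum>W\<in>Pow (D - L). \<Sum>Z\<in>Pow I. card (F1 L Z) * (card (F2 W) * card (F3 L W)))"
  proof -
    have fin: "finite (F1 L Z \<times> F2 W \<times> F3 L W)" if "L \<subseteq> D" "W \<subseteq> D - L" "Z \<subseteq> I" for L W Z
      using that by (intro finite_cartesian_product f1 f2 f3) auto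
    have s1: "card (SIGMA Z:Pow I. F1 L Z \<times> F2 W \<times> F3 L W) = (\<Sum>Z\<in>Pow I. card (F1 L Z) * (card (F2 W) * card (F3 L W)))"
      if "L \<subseteq> D" "W \<subseteq> D - L" for L W
      using that I fin by (subst card_SigmaI) (auto simp: card_cartesian_product)
    have s2: "finite (SIGMA Z:Pow I. F1 L Z \<times> F2 W \<times> F3 L W)" if "L \<subseteq> D" "W \<subseteq> D - L" for L W
      using I fin[OF that] by (intro finite_SigmaI[of "Pow I"]) auto
    have s3: "card (SIGMA W:Pow (D - L). SIGMA Z:Pow I. F1 L Z \<times> F2 W \<times> F3 L W)
       = (\<Sum>W\<in>Pow (D - L). \<Sum>Z\<in>Pow I. card (F1 L Z) * (card (F2 W) * card (F3 L W)))" if "L \<subseteq> D" for L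
      using that fD s2 s1 by (subst card_SigmaI) auto
    have s4: "finite (SIGMA W:Pow (D - L). SIGMA Z:Pow I. F1 L Z \<times> F2 W \<times> F3 L W)" if "L \<subseteq> D" for L
      using fD s2[OF that] by (intro finite_SigmaI[of "Pow (D - L)"]) auto
    show ?thesis using fD s3 s4 by (subst card_SigmaI) auto
  qed
  finally have "real (card Q) \<le> (\<Sum>L\<in>Pow D. \<Sum>W\<in>Pow (D - L). \<Sum>Z\<in>Pow I. real (card (F1 L Z)) * (real (card (F2 W)) * real (card (F3 L W))))"
    by (simp flip: of_nat_mult of_nat_sum)
  then have "real (card Q) * \<kappa> ^ \<delta> \<le> (\<Sum>L\<in>Pow D. \<Sum>W\<in>Pow (D - L). \<Sum>Z\<in>Pow I. real (card (F1 L Z)) * (real (card (F2 W)) * real (card (F3 L W)))) * \<kappa> ^ \<delta>"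
    using \<kappa> by (intro mult_right_mono) auto
  also have "\<dots> = (\<Sum>L\<in>Pow D. (\<Sum>Z\<in>Pow I. real (card (F1 L Z))) * (\<Sum>W\<in>Pow (D - L). real (card (F2 W)) * (real (card (F3 L W)) * \<kappa> ^ \<delta>)))"
    unfolding sum_distrib_right
  proof (rule sum.cong[OF refl])
    fix L :: "'a set"
    show "(\<Sum>W\<in>Pow (D - L). \<Sum>Z\<in>Pow I. real (card (F1 L Z)) * (real (card (F2 W)) * real (card (F3 L W))) * \<kappa> ^ \<delta>)
       = (\<Sum>Z\<in>Pow I. real (card (F1 L Z)) * (\<Sum>W\<in>Pow (D - L). real (card (F2 W)) * (real (card (F3 L W)) * \<kappa> ^ \<delta>)))"
      unfolding sum_distrib_left by (subst sum.swap) (simp add: mult.assoc)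
  qed
  also have "\<dots> \<le> (\<Sum>L\<in>Pow D. (\<Sum>Z\<in>Pow I. real (card (F1 L Z))) * (exp (real n - real m) * y ^ card L * (fact (d - card L) * exp \<kappa> ^ m)))"
  proof (intro sum_mono mult_left_mono sum_nonneg)
    fix L assume "L \<in> Pow D"
    then have L: "L \<subseteq> D" "finite L" "card L \<le> d" using finL fD by (auto simp: d_def card_mono)
    have cDL: "card (D - L) = d - card L" using L by (simp add: card_Diff_subset d_def)
    have F3: "real (card (F3 L W)) * \<kappa> ^ \<delta> \<le> fact (d - card L - card W) * (exp (real n - real m) * y ^ card L * \<kappa> ^ card W)"
      if "W \<in> Pow (D - L)" for W
    proof -
      let ?D = "D - L - W" and ?B = "V - X I - L" and ?S = "W \<inter> D0"
      have W: "W \<subseteq> D - L" "finite W" using that fD by (auto intro: finite_subset)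
      have cD: "card ?D = d - card L - card W" using W by (simp add: card_Diff_subset cDL)
      have S: "?S \<subseteq> ?B" using W V XI by auto
      have fS: "finite ?S" using W by auto
      have "card (V - X I) = n - m" using XI finX[of I] by (simp add: card_Diff_subset n_def m_def)
      moreover have LV: "L \<subseteq> V - X I" using L V XI by auto
      ultimately have "card ?B = n - m - card L" using L by (simp add: card_Diff_subset)
      moreover have "m \<le> n" using XI V by (auto simp: m_def n_def intro: card_mono)
      moreover have "card L \<le> n - m"
        using card_mono[OF _ LV] V \<open>card (V - X I) = n - m\<close> by auto
      ultimately have cB: "real (card ?B) = real n - real m - real (card L)" by simp
      have "real (card ?S) \<le> card ?B" using card_mono[OF _ S] V by auto
      then have cBS: "real (card (?B - ?S)) = real n - real m - real (card L) - real (card ?S)"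
        using cB S fS by (simp add: card_Diff_subset)
      \<comment> \<open>The whole of \<open>?D\<close> is mapped, so the count is the single term,
        of weight \<open>fact 0\<close>, of a sum that \<open>sum_card_covering_maps_le\<close>
        bounds.\<close>
      have "real (card (F3 L W)) = (\<Sum>L'\<in>{?D}. (1::real) ^ card L' * fact (card ?D - card L') * card {f \<in> L' \<rightarrow>\<^sub>E ?B. ?S \<subseteq> f ` L'})"
        by (simp add: F3_def)
      also have "\<dots> \<le> (\<Sum>L'\<in>Pow ?D. (1::real) ^ card L' * fact (card ?D - card L') * card {f \<in> L' \<rightarrow>\<^sub>E ?B. ?S \<subseteq> f ` L'})"
        using fD by (intro sum_mono2) auto
      also have "\<dots> \<le> fact (card ?D) * (exp 1 ^ card (?B - ?S) * (exp 1 - 1) ^ card ?S)"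
        using V fD S by (intro sum_card_covering_maps_le) auto
      also have "exp 1 - 1 = exp 1 * \<kappa>" by (simp add: \<kappa>_def algebra_simps flip: exp_add)
      also have "exp 1 ^ card (?B - ?S) * (exp 1 * \<kappa>) ^ card ?S = exp (real (card (?B - ?S)) + real (card ?S)) * \<kappa> ^ card ?S"
        by (simp add: power_mult_distrib exp_add exp_of_nat_mult[of _ 1, simplified])
      \<comment> \<open>Each of the \<open>card L\<close> forbidden values costs a factor
        \<open>exp 1\<close>. This creates the weight \<open>y ^ card L\<close>, so the later sum
        over \<open>L\<close> has \<open>x = exp (- 1)\<close>.\<close>
      also have "real (card (?B - ?S)) + real (card ?S) = (real n - real m) + real (card L) * (- 1)"
        using cBS by simp
      also have "exp \<dots> = exp (real n - real m) * y ^ card L"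
        unfolding exp_add exp_of_nat_mult y_def ..
      finally have *: "real (card (F3 L W)) \<le> fact (card ?D) * (exp (real n - real m) * y ^ card L * \<kappa> ^ card ?S)" .
      have "card W \<le> card (?S \<union> (D - D0))" using W fD by (intro card_mono) auto
      also have "\<dots> \<le> card ?S + \<delta>" unfolding \<delta>_def by (rule card_Un_le)
      finally have "\<kappa> ^ card ?S * \<kappa> ^ \<delta> \<le> \<kappa> ^ card W"
        unfolding power_add[symmetric] using \<kappa> by (intro power_decreasing) auto
      then have "fact (card ?D) * (exp (real n - real m) * y ^ card L) * (\<kappa> ^ card ?S * \<kappa> ^ \<delta>)
          \<le> fact (card ?D) * (exp (real n - real m) * y ^ card L) * \<kappa> ^ card W"
        using y by (intro mult_left_mono) auto
      moreover have "real (card (F3 L W)) * \<kappa> ^ \<delta> \<le> fact (card ?D) * (exp (real n - real m) * y ^ card L * \<kappa> ^ card ?S) * \<kappa> ^ \<delta>"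
        using * \<kappa> by (intro mult_right_mono) auto
      ultimately show ?thesis by (simp add: cD mult_ac)
    qed
    have "(\<Sum>W\<in>Pow (D - L). real (card (F2 W)) * (real (card (F3 L W)) * \<kappa> ^ \<delta>))
       \<le> (\<Sum>W\<in>Pow (D - L). real (card (F2 W)) * (fact (d - card L - card W) * (exp (real n - real m) * y ^ card L * \<kappa> ^ card W)))"
      using F3 by (intro sum_mono mult_left_mono) auto
    also have "\<dots> = exp (real n - real m) * y ^ card L *
        (\<Sum>W\<in>Pow (D - L). \<kappa> ^ card W * fact (card (D - L) - card W) * card {f \<in> W \<rightarrow>\<^sub>E X I. {} \<subseteq> f ` W})"
      unfolding sum_distrib_left F2_def cDL by (intro sum.cong) (auto simp: mult_ac)
    also have "\<dots> \<le> exp (real n - real m) * y ^ card L * (fact (card (D - L)) * (exp \<kappa> ^ card (X I - {}) * (exp \<kappa> - 1) ^ card ({} :: 'a set)))"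
      using y \<kappa> finX[of I] fD by (intro mult_left_mono sum_card_covering_maps_le) auto
    finally show "(\<Sum>W\<in>Pow (D - L). real (card (F2 W)) * (real (card (F3 L W)) * \<kappa> ^ \<delta>))
       \<le> exp (real n - real m) * y ^ card L * (fact (d - card L) * exp \<kappa> ^ m)"
      by (simp add: cDL m_def)
  qed auto
  also have "\<dots> = exp (real n - real m) * exp \<kappa> ^ m * (\<Sum>Z\<in>Pow I. \<Sum>L\<in>Pow D. y ^ card L * fact (d - card L) * real (card (F1 L Z)))"
    unfolding sum_distrib_left sum_distrib_right by (subst sum.swap) (simp add: mult_ac)
  also have "\<dots> \<le> exp (real n - real m) * exp \<kappa> ^ m * (\<Sum>Z\<in>Pow I. fact d * ((exp y - 1)\<^sup>2) ^ card Z)"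
  proof (intro mult_left_mono sum_mono)
    fix Z assume Z: "Z \<in> Pow I"
    have "(\<Sum>L\<in>Pow D. y ^ card L * fact (card D - card L) * real (card {f \<in> L \<rightarrow>\<^sub>E X Z. X Z \<subseteq> f ` L}))
       \<le> fact (card D) * (exp y ^ card (X Z - X Z) * (exp y - 1) ^ card (X Z))"
      using finX Z fD y by (intro sum_card_covering_maps_le) auto
    then show "(\<Sum>L\<in>Pow D. y ^ card L * fact (d - card L) * real (card (F1 L Z))) \<le> fact d * ((exp y - 1)\<^sup>2) ^ card Z"
      using Z by (simp add: F1_def d_def cardX power_mult)
  qed auto
  also have "\<dots> = fact d * (exp (real n - real m) * exp \<kappa> ^ m) * (1 + (exp y - 1)\<^sup>2) ^ card I"
    by (simp add: sum_distrib_left[symmetric] sum_Pow_power_card[OF I])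
  \<comment> \<open>Each paired value contributes \<open>exp (\<kappa> - 1) = exp (- y)\<close>, and
    every index has two of them.\<close>
  also have "exp (real n - real m) * exp \<kappa> ^ m = exp (real n) * exp (- 2 * y) ^ card I"
  proof -
    have "exp (real n - real m) * exp \<kappa> ^ m = exp (real n - real m + real m * \<kappa>)"
      by (simp add: exp_add exp_of_nat_mult)
    also have "real n - real m + real m * \<kappa> = real n + real (card I) * (- 2 * y)"
      by (simp add: \<kappa>(3) m_def cardX algebra_simps)
    finally show ?thesis unfolding exp_add exp_of_nat_mult .
  qed
  finally show ?thesis
    by (simp add: Q_def \<delta>_def d_def n_def match_rate_def y_def power_mult_distrib mult_ac)
qed

section \<open>A lower bound for the number of labelled trees\<close>

text \<open>Rooted forests on \<open>V\<close> with root set \<open>R\<close>, given by their parent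
  maps; the existence of a decreasing rank expresses acyclicity.\<close>

definition ranked_maps :: "'a set \<Rightarrow> 'a set \<Rightarrow> ('a \<Rightarrow> 'a) set" where
  "ranked_maps V R = {g \<in> (V - R) \<rightarrow>\<^sub>E V. \<exists>rk::'a \<Rightarrow> nat. \<forall>x\<in>V - R. rk (g x) < rk x}"

lemma finite_ranked_maps: "finite V \<Longrightarrow> finite (ranked_maps V R)"
  unfolding ranked_maps_def
  by (rule finite_subset[OF _ finite_PiE[of "V - R" "\<lambda>_. V"]]) auto

text \<open>Absorbing \<open>j\<close> into the binomial coefficient leaves \<open>M\<close> times a
  binomial expansion of exponent \<open>M - 1\<close>. This evaluates the recursion for forests in
  \<open>card_ranked_maps_ge\<close>.\<close>

lemma sum_binomial_weighted:
  fixes r M :: nat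
  assumes "M > 0"
  shows "(\<Sum>j\<le>M. (M choose j) * (r ^ j * (j * M ^ (M - j)))) = M * (r * (r + M) ^ (M - 1))"
proof -
  obtain N where M: "M = Suc N" using assms by (cases M) auto
  have "(\<Sum>j\<le>M. (M choose j) * (r ^ j * (j * M ^ (M - j))))
      = (\<Sum>j\<le>N. (M choose Suc j) * (r ^ Suc j * (Suc j * M ^ (M - Suc j))))"
    unfolding M by (subst sum.atMost_Suc_shift) simp
  also have "\<dots> = (\<Sum>j\<le>N. M * (r * ((N choose j) * r ^ j * M ^ (N - j))))"
  proof (rule sum.cong[OF refl])
    fix j
    have abs: "Suc j * (M choose Suc j) = M * (N choose j)" unfolding M by (rule Suc_times_binomial)
    have "(M choose Suc j) * (r ^ Suc j * (Suc j * M ^ (M - Suc j))) = (Suc j * (M choose Suc j)) * (r ^ Suc j * M ^ (N - j))"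
      by (simp only: M mult_ac diff_Suc_Suc)
    also have "\<dots> = M * (r * ((N choose j) * r ^ j * M ^ (N - j)))"
      unfolding abs by (simp only: power_Suc mult_ac)
    finally show "(M choose Suc j) * (r ^ Suc j * (Suc j * M ^ (M - Suc j))) = M * (r * ((N choose j) * r ^ j * M ^ (N - j)))" .
  qed
  also have "\<dots> = M * (r * (r + M) ^ N)"
    by (simp add: binomial sum_distrib_left)
  finally show ?thesis by (simp add: M)
qed

text \<open>\<open>S\<close> is the set of vertices mapped directly into \<open>R\<close>.\<close>

lemma card_ranked_maps_step:
  assumes "finite V" "R \<subseteq> V"
  shows "(\<Sum>S\<in>Pow (V - R). card R ^ card S * card (ranked_maps (V - R) S)) \<le> card (ranked_maps V R)"
proof -
  let ?A = "SIGMA S:Pow (V - R). (S \<rightarrow>\<^sub>E R) \<times> ranked_maps (V - R) S"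
  let ?h = "\<lambda>(S, f, g). (\<lambda>x. if x \<in> S then f x else g x)"
  have finS: "finite S" if "S \<in> Pow (V - R)" for S using that assms by (auto intro: finite_subset)
  have finR: "finite R" using assms finite_subset by blast
  have "(\<Sum>S\<in>Pow (V - R). card R ^ card S * card (ranked_maps (V - R) S))
     = (\<Sum>S\<in>Pow (V - R). card ((S \<rightarrow>\<^sub>E R) \<times> ranked_maps (V - R) S))"
    using finS by (intro sum.cong) (auto simp: card_cartesian_product card_PiE)
  also have "\<dots> = card ?A"
    using assms finS finR by (intro card_SigmaI[symmetric]) (auto intro!: finite_PiE finite_ranked_maps)
  also have "\<dots> \<le> card (ranked_maps V R)"
  proof (rule card_inj_on_le[where f = ?h])
    show "finite (ranked_maps V R)" by (rule finite_ranked_maps[OF assms(1)])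
    show "?h ` ?A \<subseteq> ranked_maps V R"
    proof clarify
      fix S f g assume S: "S \<subseteq> V - R" and f: "f \<in> S \<rightarrow>\<^sub>E R" and g: "g \<in> ranked_maps (V - R) S"
      obtain rk :: "'a \<Rightarrow> nat" where rk: "\<And>x. x \<in> V - R - S \<Longrightarrow> rk (g x) < rk x" and gP: "g \<in> (V - R - S) \<rightarrow>\<^sub>E (V - R)"
        using g by (auto simp: ranked_maps_def)
      \<comment> \<open>Elements of \<open>S\<close> are sent into \<open>R\<close>, so
        \<open>R\<close> takes rank 0 and all other ranks move up by one.\<close>
      define rk' where "rk' = (\<lambda>x. if x \<in> R then 0 else Suc (rk x))"
      have "rk' (if x \<in> S then f x else g x) < rk' x" if "x \<in> V - R" for x
        using that rk[of x] f gP by (auto simp: rk'_def)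
      then have "\<exists>rk::'a \<Rightarrow> nat. \<forall>x\<in>V - R. rk (if x \<in> S then f x else g x) < rk x" by blast
      moreover have "(\<lambda>x. if x \<in> S then f x else g x) \<in> (V - R) \<rightarrow>\<^sub>E V"
      proof (rule PiE_I)
        fix x assume "x \<in> V - R"
        then show "(if x \<in> S then f x else g x) \<in> V"
          using PiE_mem[OF f, of x] PiE_mem[OF gP, of x] assms(2) by auto
      next
        fix x assume "x \<notin> V - R"
        then show "(if x \<in> S then f x else g x) = undefined"
          using S PiE_arb[OF gP, of x] by auto
      qed
      ultimately show "(\<lambda>x. if x \<in> S then f x else g x) \<in> ranked_maps V R"
        by (simp add: ranked_maps_def)
    qed
    show "inj_on ?h ?A"
    proof (rule inj_onI)
      fix t t' assume t: "t \<in> ?A" and t': "t' \<in> ?A" and eq: "?h t = ?h t'"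
      obtain S f g where tt: "t = (S, f, g)" by (cases t)
      obtain S' f' g' where tt': "t' = (S', f', g')" by (cases t')
      note m = t[unfolded tt] t'[unfolded tt']
      have f: "f \<in> S \<rightarrow>\<^sub>E R" "f' \<in> S' \<rightarrow>\<^sub>E R" and SS: "S \<subseteq> V - R" "S' \<subseteq> V - R"
        and g: "g \<in> (V - R - S) \<rightarrow>\<^sub>E (V - R)" "g' \<in> (V - R - S') \<rightarrow>\<^sub>E (V - R)"
        using m by (auto simp: ranked_maps_def)
      have eq': "(if x \<in> S then f x else g x) = (if x \<in> S' then f' x else g' x)" for x
        using fun_cong[OF eq, of x] by (simp add: tt tt')
      \<comment> \<open>\<open>S0\<close> can be read off from the glued map as the set of points
        sent into \<open>R\<close>, because \<open>g0\<close> stays outside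
        \<open>R\<close>.\<close>
      have zone: "S0 = {x \<in> V - R. (if x \<in> S0 then f0 x else g0 x) \<in> R}"
        if "f0 \<in> S0 \<rightarrow>\<^sub>E R" "S0 \<subseteq> V - R" "g0 \<in> (V - R - S0) \<rightarrow>\<^sub>E (V - R)" for S0 and f0 g0 :: "'a \<Rightarrow> 'a"
        using that(2) PiE_mem[OF that(1)] PiE_mem[OF that(3)] by (intro set_eqI) auto
      have S: "S = S'" using zone[OF f(1) SS(1) g(1)] zone[OF f(2) SS(2) g(2)] eq' by simp
      have "f = f'"
      proof
        fix x show "f x = f' x"
          using eq'[of x] S PiE_arb[OF f(1), of x] PiE_arb[OF f(2), of x] by (cases "x \<in> S") auto
      qed
      moreover have "g = g'"
      proof
        fix x show "g x = g' x"
          using eq'[of x] S PiE_arb[OF g(1), of x] PiE_arb[OF g(2), of x] by (cases "x \<in> S") auto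
      qed
      ultimately show "t = t'" using S tt tt' by simp
    qed
  qed
  finally show ?thesis .
qed

text \<open>The lower bound in Cayley's formula for forests,
  \<open>card R * card V ^ (card (V - R) - 1)\<close>, multiplied by \<open>card V\<close> so that
  \<open>R = V\<close> causes no negative exponent. In the induction the vertices sent directly into
  \<open>R\<close> become the roots of a forest on \<open>V - R\<close>.\<close>

lemma card_ranked_maps_ge:
  assumes "finite V" "R \<subseteq> V"
  shows "card R * card V ^ card (V - R) \<le> card V * card (ranked_maps V R)"
  using assms
proof (induction "card V" arbitrary: V R rule: less_induct)
  case less
  show ?case
  proof (cases "R = V")
    case True
    then have "ranked_maps V R = {\<lambda>_. undefined}" by (auto simp: ranked_maps_def)
    then show ?thesis using True by simp
  next
    case False
    show ?thesis
    proof (cases "R = {}")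
      case True
      then show ?thesis by simp
    next
      case R: False
      let ?M = "card (V - R)"
      have fin: "finite R" "finite (V - R)" using less.prems by (auto intro: finite_subset)
      have M: "?M > 0" using False less.prems fin by (auto simp: card_gt_0_iff)
      have V: "card V = card R + ?M"
        using less.prems fin by (simp add: card_Diff_subset card_mono)
      have lt: "?M < card V" using R fin V by (simp add: card_gt_0_iff)
      have "?M * (card R * card V ^ (?M - 1)) = (\<Sum>S\<in>Pow (V - R). card R ^ card S * (card S * ?M ^ (?M - card S)))"
        using sum_binomial_weighted[OF M, of "card R"] by (subst sum_Pow_card[OF fin(2)]) (simp add: V)
      also have "\<dots> \<le> (\<Sum>S\<in>Pow (V - R). card R ^ card S * (?M * card (ranked_maps (V - R) S)))"
      proof (rule sum_mono)
        fix S assume S: "S \<in> Pow (V - R)"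
        then have "card (V - R - S) = ?M - card S" using fin by (intro card_Diff_subset) (auto intro: finite_subset)
        moreover have "card S * ?M ^ card (V - R - S) \<le> ?M * card (ranked_maps (V - R) S)"
          using lt S fin by (intro less.hyps) auto
        ultimately show "card R ^ card S * (card S * ?M ^ (?M - card S)) \<le> card R ^ card S * (?M * card (ranked_maps (V - R) S))"
          by simp
      qed
      also have "\<dots> = ?M * (\<Sum>S\<in>Pow (V - R). card R ^ card S * card (ranked_maps (V - R) S))"
        by (simp add: sum_distrib_left mult_ac)
      also have "\<dots> \<le> ?M * card (ranked_maps V R)"
        using card_ranked_maps_step[OF less.prems] by simp
      finally have "card R * card V ^ (?M - 1) \<le> card (ranked_maps V R)" using M by simp
      then have "card V * (card R * card V ^ (?M - 1)) \<le> card V * card (ranked_maps V R)" by simp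
      moreover have "card V * (card R * card V ^ (?M - 1)) = card R * card V ^ ?M"
        using M by (simp add: mult.left_commute flip: power_Suc)
      ultimately show ?thesis by metis
    qed
  qed
qed

section \<open>Trees as graphs of ranked maps\<close>

definition graph_of_map :: "'a set \<Rightarrow> ('a \<Rightarrow> 'a) \<Rightarrow> 'a set set" where
  "graph_of_map D g = (\<lambda>x. {x, g x}) ` D"

lemma in_graph_of_map_iff: "{x, y} \<in> graph_of_map D g \<longleftrightarrow> (x \<in> D \<and> y = g x) \<or> (y \<in> D \<and> x = g y)"
  by (auto simp: graph_of_map_def doubleton_eq_iff)

text \<open>Loops are erased while the walk is extended at its front: if the new vertex already lies
  on the path, the part before that occurrence is dropped.\<close>

lemma simple_path_if_rtrancl:
  assumes "(x, y) \<in> {(u, v). {u, v} \<in> E}\<^sup>*"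
  shows "\<exists>p. p \<noteq> [] \<and> distinct p \<and> successively (\<lambda>u v. {u, v} \<in> E) p \<and> hd p = x \<and> last p = y"
  using assms
proof (induction rule: converse_rtrancl_induct)
  case base
  show ?case by (rule exI[of _ "[y]"]) simp
next
  case (step x z)
  then obtain p where p: "p \<noteq> []" "distinct p" "successively (\<lambda>u v. {u, v} \<in> E) p" "hd p = z" "last p = y" by blast
  show ?case
  proof (cases "x \<in> set p")
    case True
    then obtain a b where ab: "p = a @ x # b" by (meson split_list)
    then show ?thesis using p by (intro exI[of _ "x # b"]) (auto simp: successively_append_iff split: if_splits)
  next
    case False
    then show ?thesis using p step by (intro exI[of _ "x # p"]) (auto simp: successively_Cons)
  qed
qed

text \<open>Iterating \<open>g\<close> lowers the rank until \<open>c\<close> is reached, and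
  adjacency is symmetric, so any two vertices are joined by a walk through \<open>c\<close>.\<close>

lemma ranked_map_connected:
  fixes rk :: "'a \<Rightarrow> nat"
  assumes g: "\<And>x. x \<in> V \<Longrightarrow> x \<noteq> c \<Longrightarrow> g x \<in> V \<and> rk (g x) < rk x"
    and "x \<in> V" "y \<in> V"
  shows "\<exists>p. p \<noteq> [] \<and> distinct p \<and> successively (\<lambda>u v. {u, v} \<in> graph_of_map (V - {c}) g) p \<and> hd p = x \<and> last p = y"
proof (rule simple_path_if_rtrancl)
  let ?R = "{(u, v). {u, v} \<in> graph_of_map (V - {c}) g}"
  have to_c: "(x, c) \<in> ?R\<^sup>*" if "x \<in> V" for x
    using that
  proof (induction "rk x" arbitrary: x rule: less_induct)
    case less
    show ?case
    proof (cases "x = c")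
      case False
      then have "(x, g x) \<in> ?R" using less by (auto simp: in_graph_of_map_iff)
      moreover have "(g x, c) \<in> ?R\<^sup>*" using less g False by blast
      ultimately show ?thesis by (rule converse_rtrancl_into_rtrancl)
    qed simp
  qed
  have "sym ?R" by (auto simp: sym_def insert_commute)
  then have "sym (?R\<^sup>*)" by (rule sym_rtrancl)
  then have "(c, y) \<in> ?R\<^sup>*" using to_c[OF assms(3)] by (auto dest: symD)
  then show "(x, y) \<in> ?R\<^sup>*" using to_c[OF assms(2)] by (rule rtrancl_trans[rotated])
qed

lemma cycle_neighbours:
  assumes "is_cycle E c" "x \<in> set c"
  obtains y z where "y \<in> set c" "z \<in> set c" "y \<noteq> z" "{x, y} \<in> E" "{x, z} \<in> E"
proof -
  define N where "N = length c"
  have N: "N \<ge> 3" and d: "distinct c" using assms by (auto simp: is_cycle_def N_def)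
  have s: "{c ! i, c ! Suc i} \<in> E" if "Suc i < N" for i
    using assms that by (auto simp: is_cycle_def N_def successively_conv_nth)
  have l: "{c ! (N - 1), c ! 0} \<in> E"
  proof -
    have "c \<noteq> []" using N by (auto simp: N_def)
    then show ?thesis using assms by (simp add: is_cycle_def N_def last_conv_nth hd_conv_nth)
  qed
  obtain i where i: "i < N" "x = c ! i" using assms(2) by (auto simp: in_set_conv_nth N_def)
  define j where "j = (if Suc i = N then 0 else Suc i)"
  define k where "k = (if i = 0 then N - 1 else i - 1)"
  have "j < N" "k < N" "j \<noteq> k" using i N by (auto simp: j_def k_def)
  moreover have "{x, c ! j} \<in> E"
    using s[of i] l i by (cases "Suc i = N") (auto simp: j_def)
  moreover have "{x, c ! k} \<in> E"
    using s[of "i - 1"] l i by (cases "i = 0") (auto simp: k_def insert_commute)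
  ultimately show ?thesis
    using that[of "c ! j" "c ! k"] d by (auto simp: N_def nth_eq_iff_index_eq)
qed

text \<open>At a vertex of maximal rank on a cycle, both neighbours along the cycle would have to be
  its image under \<open>g\<close>, although they are distinct.\<close>

lemma ranked_map_acyclic:
  fixes rk :: "'a \<Rightarrow> nat"
  assumes g: "\<And>x. x \<in> D \<Longrightarrow> rk (g x) < rk x"
  shows "\<not> is_cycle (graph_of_map D g) c"
proof
  assume c: "is_cycle (graph_of_map D g) c"
  then have "set c \<noteq> {}" by (auto simp: is_cycle_def)
  then have "Max (rk ` set c) \<in> rk ` set c" by (intro Max_in) auto
  then obtain x where x: "x \<in> set c" "rk x = Max (rk ` set c)" by auto
  then have max: "rk y \<le> rk x" if "y \<in> set c" for y using that by simp
  obtain y z where yz: "y \<in> set c" "z \<in> set c" "y \<noteq> z" "{x, y} \<in> graph_of_map D g" "{x, z} \<in> graph_of_map D g"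
    using cycle_neighbours[OF c x(1)] by blast
  have "y = g x" using yz(4) max[OF yz(1)] g[of y] by (auto simp: in_graph_of_map_iff)
  moreover have "z = g x" using yz(5) max[OF yz(2)] g[of z] by (auto simp: in_graph_of_map_iff)
  ultimately show False using yz by simp
qed

lemma graph_of_ranked_map_is_tree:
  assumes "c \<in> V" "g \<in> ranked_maps V {c}"
  shows "is_tree V (graph_of_map (V - {c}) g)"
proof -
  obtain rk :: "'a \<Rightarrow> nat" where g: "\<And>x. x \<in> V - {c} \<Longrightarrow> g x \<in> V \<and> rk (g x) < rk x"
    using assms by (auto simp: ranked_maps_def) 
  let ?E = "graph_of_map (V - {c}) g"
  have simple: "simple_graph V ?E"
    unfolding simple_graph_def
  proof
    fix e assume "e \<in> ?E"
    then obtain x where x: "x \<in> V - {c}" "e = {x, g x}" by (auto simp: graph_of_map_def)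
    then have "x \<noteq> g x" using g[OF x(1)] by auto
    then show "e \<subseteq> V \<and> card e = 2" using x g[OF x(1)] by auto
  qed
  have "\<exists>p. is_path V ?E p \<and> hd p = u \<and> last p = v" if uv: "u \<in> V" "v \<in> V" for u v
  proof -
    obtain p where p: "p \<noteq> []" "distinct p" "successively (\<lambda>u v. {u, v} \<in> ?E) p" "hd p = u" "last p = v"
      using ranked_map_connected[of V c g rk u v] g uv by blast
    have "set p \<subseteq> V"
    proof
      fix w assume "w \<in> set p"
      then obtain i where i: "i < length p" "w = p ! i" by (auto simp: in_set_conv_nth)
      show "w \<in> V"
      proof (cases i)
        case 0
        then show ?thesis using i p uv by (auto simp: hd_conv_nth)
      next
        case (Suc j)
        then have "{p ! j, w} \<in> ?E" using i p by (auto simp: successively_conv_nth)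
        then show ?thesis using simple by (auto simp: simple_graph_def)
      qed
    qed
    then show ?thesis using p by (auto simp: is_path_def)
  qed
  then show ?thesis
    using simple assms(1) ranked_map_acyclic[of "V - {c}" rk g] g
    by (auto simp: is_tree_def connected_graph_def)
qed

text \<open>If \<open>x\<close> is of minimal rank with \<open>g x \<noteq> h x\<close>, then the edge from \<open>x\<close> to \<open>h x\<close> forces \<open>g (h x) = x\<close>,
  so \<open>h (h x) = x\<close> by minimality, against the ranking.\<close>

lemma inj_on_graph_of_map: "inj_on (graph_of_map (V - {c})) (ranked_maps V {c})"
proof (rule inj_onI)
  fix g h assume g: "g \<in> ranked_maps V {c}" and h: "h \<in> ranked_maps V {c}"
    and eq: "graph_of_map (V - {c}) g = graph_of_map (V - {c}) h"
  obtain rk :: "'a \<Rightarrow> nat" where rk: "\<And>x. x \<in> V - {c} \<Longrightarrow> rk (h x) < rk x"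
    using h by (auto simp: ranked_maps_def)
  have "g x = h x" if "x \<in> V - {c}" for x
    using that
  proof (induction "rk x" arbitrary: x rule: less_induct)
    case less
    have "{x, h x} \<in> graph_of_map (V - {c}) g" unfolding eq using less by (auto simp: in_graph_of_map_iff)
    then consider "h x = g x" | "h x \<in> V - {c}" "x = g (h x)" unfolding in_graph_of_map_iff by blast
    then show ?case
    proof cases
      case 2
      then have "g (h x) = h (h x)" using less rk by blast
      with 2 rk[of x] rk[of "h x"] less.prems show ?thesis by force
    qed simp
  qed
  then show "g = h"
    using g h unfolding ranked_maps_def by (intro ext) (metis (no_types, lifting) PiE_arb mem_Collect_eq)
qed

text \<open>For \<open>n \<ge> 2\<close> this is
  \<open>n ^ (n - 2) \<le> card (labelled_trees n)\<close>. It comes from the forests with the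
  single root 1, whose graphs are pairwise different trees.\<close>

lemma card_labelled_trees_ge:
  assumes "n \<ge> 1"
  shows "n ^ (n - 1) \<le> n * card (labelled_trees n)"
proof -
  have "card {1::nat} * card {1..n} ^ card ({1..n} - {1}) \<le> card {1..n} * card (ranked_maps {1..n} {1})"
    using assms by (intro card_ranked_maps_ge) auto
  then have "n ^ (n - 1) \<le> n * card (ranked_maps {1..n} {1})"
    using assms by (simp add: card_Diff_subset)
  moreover have "card (ranked_maps {1..n} {1}) \<le> card (labelled_trees n)"
    using assms graph_of_ranked_map_is_tree[of 1 "{1..n}"]
    by (intro card_inj_on_le[OF inj_on_graph_of_map]) (auto simp: labelled_trees_def finite_labelled_trees[unfolded labelled_trees_def, simplified])
  ultimately show ?thesis using mult_le_mono2 order_trans by blast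
qed

section \<open>Paths in rooted trees\<close>

text \<open>The rank is the distance to \<open>c\<close>, and the parent is some neighbour of
  smaller rank. The graph of the parent map is connected, so an edge of \<open>E\<close> outside it
  would close a cycle together with a path inside it.\<close>

lemma tree_has_parent_map:
  assumes tree: "is_tree V E" and c: "c \<in> V"
  obtains par and rk :: "'a \<Rightarrow> nat"
    where "\<And>x. x \<in> V - {c} \<Longrightarrow> par x \<in> V \<and> rk (par x) < rk x" "E = graph_of_map (V - {c}) par"
proof -
  let ?R = "{(u, v). {u, v} \<in> E}"
  define rk where "rk = (\<lambda>x. LEAST k. (x, c) \<in> ?R ^^ k)"
  have simple: "e \<subseteq> V" "card e = 2" if "e \<in> E" for e
    using tree that by (auto simp: is_tree_def simple_graph_def)
  have walk: "(hd p, last p) \<in> ?R\<^sup>*" if "p \<noteq> []" "successively (\<lambda>u v. {u, v} \<in> E) p" for p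
    using that
  proof (induction p)
    case (Cons x p)
    show ?case
    proof (cases "p = []")
      case False
      then have "(x, hd p) \<in> ?R" "(hd p, last p) \<in> ?R\<^sup>*" using Cons by (auto simp: successively_Cons)
      then show ?thesis using False by (auto intro: converse_rtrancl_into_rtrancl)
    qed simp
  qed simp
  have "\<exists>y. y \<in> V \<and> rk y < rk x \<and> {x, y} \<in> E" if x: "x \<in> V - {c}" for x
  proof -
    obtain p where "is_path V E p" "hd p = x" "last p = c"
      using tree c x unfolding is_tree_def connected_graph_def by blast
    then have "(x, c) \<in> ?R\<^sup>*" using walk[of p] by (auto simp: is_path_def)
    then obtain k where "(x, c) \<in> ?R ^^ k" using rtrancl_imp_relpow by blast
    then have rk: "(x, c) \<in> ?R ^^ rk x" unfolding rk_def by (rule LeastI)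
    then have "rk x \<noteq> 0" using x by (intro notI) simp
    then obtain j where j: "rk x = Suc j" using not0_implies_Suc by blast
    then obtain y where y: "(x, y) \<in> ?R" "(y, c) \<in> ?R ^^ j"
      using relpow_Suc_D2[of x c j ?R] rk by auto
    have "rk y \<le> j" unfolding rk_def using y(2) by (rule Least_le)
    then show ?thesis using y j simple(1)[of "{x, y}"] by auto
  qed
  then obtain par where par: "\<And>x. x \<in> V - {c} \<Longrightarrow> par x \<in> V \<and> rk (par x) < rk x \<and> {x, par x} \<in> E"
    by metis
  have sub: "graph_of_map (V - {c}) par \<subseteq> E" using par by (auto simp: graph_of_map_def)
  moreover have "E \<subseteq> graph_of_map (V - {c}) par"
  proof
    fix e assume e: "e \<in> E"
    obtain x y where xy: "e = {x, y}" "x \<noteq> y" using simple(2)[OF e] by (auto simp: card_2_iff)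
    have "x \<in> V" "y \<in> V" using simple(1)[OF e] xy by auto
    then obtain p where p: "p \<noteq> []" "distinct p" "successively (\<lambda>u v. {u, v} \<in> graph_of_map (V - {c}) par) p"
        "hd p = x" "last p = y"
      using ranked_map_connected[of V c par rk x y] par by blast
    show "e \<in> graph_of_map (V - {c}) par"
    proof (rule ccontr)
      assume ne: "e \<notin> graph_of_map (V - {c}) par"
      have "length p \<ge> 3"
      proof (rule ccontr)
        assume "\<not> 3 \<le> length p"
        moreover have "length p > 0" using p(1) by simp
        ultimately have "length p = 1 \<or> length p = 2" by linarith
        then have "p = [x] \<or> p = [x, y]"
          using p(4,5) by (auto simp: length_Suc_conv numeral_2_eq_2)
        then show False
        proof
          assume "p = [x]"
          then show False using p(5) xy(2) by simp
        next
          assume "p = [x, y]"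
          then show False using p(3) xy(1) ne by simp
        qed
      qed
      moreover have "successively (\<lambda>u v. {u, v} \<in> E) p"
        using p(3) sub by (auto elim: successively_mono)
      moreover have "{last p, hd p} \<in> E" using p e xy by (simp add: insert_commute)
      ultimately have "is_cycle E p" using p by (simp add: is_cycle_def)
      then show False using tree by (simp add: is_tree_def)
    qed
  qed
  ultimately show ?thesis using that[of par rk] par by blast
qed

definition path_edges :: "'a list \<Rightarrow> 'a set set" where
  "path_edges p = {{p ! i, p ! Suc i} | i. Suc i < length p}"

text \<open>The vertices whose parent cannot be read off from the two paths. An apex stays in the
  set unless it is \<open>c\<close> or a non-apex vertex of the other path.\<close>

definition free_vertices :: "'a set \<Rightarrow> 'a \<Rightarrow> 'a list \<Rightarrow> 'a list \<Rightarrow> nat \<Rightarrow> nat \<Rightarrow> 'a set" where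
  "free_vertices V c p q a b = V - {c} - (set p - {p ! a}) - (set q - {q ! b})"

lemma free_vertices_commute: "free_vertices V c p q a b = free_vertices V c q p b a"
  by (auto simp: free_vertices_def)

lemma degree_ne_1:
  assumes "{w, x} \<in> F" "{w, y} \<in> F" "x \<noteq> y"
  shows "degree F w \<noteq> 1"
proof
  assume "degree F w = 1"
  then obtain z where "neighbours F w = {z}" unfolding degree_def by (rule card_1_singletonE)
  then have "x = z" "y = z" using assms(1,2) unfolding neighbours_def by blast+
  then show False using assms(3) by simp
qed

lemma degree_interior_ne_1:
  assumes "is_path V F p" "0 < j" "Suc j < length p"
  shows "degree F (p ! j) \<noteq> 1"
proof (rule degree_ne_1)
  have edge: "{p ! i, p ! Suc i} \<in> F" if "Suc i < length p" for i
    using assms that by (auto simp: is_path_def successively_conv_nth)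
  show "{p ! j, p ! (j - 1)} \<in> F" "{p ! j, p ! Suc j} \<in> F"
    using edge[of "j - 1"] edge[of j] assms by (auto simp: insert_commute)
  show "p ! (j - 1) \<noteq> p ! Suc j" using assms by (auto simp: is_path_def nth_eq_iff_index_eq)
qed

section \<open>Apexes of paths and leaf neighbours of path vertices\<close>

locale rooted_tree =
  fixes V :: "'a set" and c :: 'a and par :: "'a \<Rightarrow> 'a" and rk :: "'a \<Rightarrow> nat"
  assumes parent: "x \<in> V - {c} \<Longrightarrow> par x \<in> V \<and> rk (par x) < rk x"
begin

abbreviation "E \<equiv> graph_of_map (V - {c}) par"

definition apex :: "'a list \<Rightarrow> nat \<Rightarrow> bool" where
  "apex p a \<longleftrightarrow> a < length p \<and> (\<forall>i<a. p ! i \<noteq> c \<and> par (p ! i) = p ! Suc i)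
     \<and> (\<forall>i. a < i \<and> i < length p \<longrightarrow> p ! i \<noteq> c \<and> par (p ! i) = p ! (i - 1))"

text \<open>The apex is the first position from which the path does not step to the parent. From
  there on it only descends: after a step down, the parent is the previous vertex, and a path does
  not return to it.\<close>

lemma apex_exists:
  assumes "is_path V E p"
  obtains a where "apex p a"
proof -
  have edge: "{p ! i, p ! Suc i} \<in> E" if "Suc i < length p" for i
    using assms that by (auto simp: is_path_def successively_conv_nth)
  have d: "distinct p" and ne: "p \<noteq> []" using assms by (auto simp: is_path_def)
  let ?up = "\<lambda>i. p ! i \<noteq> c \<and> par (p ! i) = p ! Suc i"
  let ?down = "\<lambda>i. p ! i \<noteq> c \<and> par (p ! i) = p ! (i - 1)"
  \<comment> \<open>The last position counts as a stop because it has no successor; this also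
    guarantees that the least stop exists.\<close>
  let ?P = "\<lambda>i. i = length p - 1 \<or> \<not> ?up i"
  define a where "a = (LEAST i. ?P i)"
  have a: "?P a" unfolding a_def by (rule LeastI[where k = "length p - 1"]) simp
  have "a \<le> length p - 1" unfolding a_def by (rule Least_le) simp
  then have "a < length p" using ne by (cases p) auto
  moreover have "?up i" if "i < a" for i using not_less_Least[of i ?P] that unfolding a_def by blast
  moreover have "?down i" if "a < i" "i < length p" for i
  proof -
    have "Suc a \<le> i" using that by simp
    then show ?thesis using that(2)
    proof (induction i rule: dec_induct)
      case base
      then have "\<not> ?up a" using a by auto
      then show ?case using edge[OF base] by (auto simp: in_graph_of_map_iff)
    next
      case (step i)
      have "p ! Suc i \<noteq> p ! (i - 1)" using step d by (simp add: nth_eq_iff_index_eq)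
      then have "\<not> ?up i" using step by auto
      then show ?case using edge[of i] step by (auto simp: in_graph_of_map_iff)
    qed
  qed
  ultimately have "apex p a" unfolding apex_def by blast
  then show ?thesis by (rule that)
qed

lemma nonapex_parent:
  assumes "apex p a" "set p \<subseteq> V" "z \<in> set p - {p ! a}"
  shows "z \<in> V - {c}" "{z, par z} \<in> path_edges p" "par z \<in> set p"
proof -
  obtain i where i: "i < length p" "z = p ! i" "i \<noteq> a" using assms(3) by (auto simp: in_set_conv_nth)
  then consider "i < a" | "a < i" by linarith
  then have "z \<noteq> c \<and> (\<exists>j. Suc j < length p \<and> {z, par z} = {p ! j, p ! Suc j})"
  proof cases
    case 1
    then show ?thesis using assms(1) i by (auto simp: apex_def intro!: exI[of _ i])
  next
    case 2
    then show ?thesis using assms(1) i by (auto simp: apex_def insert_commute intro!: exI[of _ "i - 1"])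
  qed
  then obtain j where j: "z \<noteq> c" "Suc j < length p" "{z, par z} = {p ! j, p ! Suc j}" by blast
  then show "z \<in> V - {c}" "{z, par z} \<in> path_edges p" using assms by (auto simp: path_edges_def)
  have "{z, par z} \<subseteq> set p" unfolding j(3) using j(2) by auto
  then show "par z \<in> set p" by simp
qed

lemma apex_has_child:
  assumes "apex p a" "set p \<subseteq> V" "length p \<ge> 2"
  obtains z where "z \<in> V - {c}" "par z = p ! a"
proof (cases "a = 0")
  case True
  then have "p ! 1 \<noteq> c" "par (p ! 1) = p ! a" using assms by (auto simp: apex_def)
  moreover have "p ! 1 \<in> V" using assms by auto
  ultimately show ?thesis using that by blast
next
  case False
  then have "p ! (a - 1) \<noteq> c" "par (p ! (a - 1)) = p ! a" "a - 1 < length p" using assms by (auto simp: apex_def)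
  moreover from this have "p ! (a - 1) \<in> V" using assms by auto
  ultimately show ?thesis using that by blast
qed

lemma degree_parent_ne_1:
  assumes "z \<in> V - {c}" "par z \<noteq> c"
  shows "degree E (par z) \<noteq> 1"
proof (rule degree_ne_1)
  have pz: "par z \<in> V - {c}" using parent[OF assms(1)] assms(2) by simp
  show "{par z, z} \<in> E" "{par z, par (par z)} \<in> E" using assms pz by (auto simp: in_graph_of_map_iff)
  show "z \<noteq> par (par z)" using parent[OF assms(1)] parent[OF pz] by auto
qed

text \<open>Each edge joins a vertex to its parent. That vertex is either free, so that
  \<open>par\<close> restricted to \<open>D\<close> yields the edge, or a non-apex path vertex, so
  that the edge belongs to a path.\<close>

lemma edges_eq:
  assumes p: "is_path V E p" "apex p a" and q: "is_path V E q" "apex q b"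
  defines "D \<equiv> free_vertices V c p q a b"
  shows "E = graph_of_map D (restrict par D) \<union> path_edges p \<union> path_edges q"
proof
  have path: "path_edges p \<subseteq> E" if "is_path V E p" for p
    using that by (auto simp: path_edges_def is_path_def successively_conv_nth)
  have "{x, restrict par D x} \<in> E" if "x \<in> D" for x
    using that by (auto simp: D_def free_vertices_def in_graph_of_map_iff)
  then show "graph_of_map D (restrict par D) \<union> path_edges p \<union> path_edges q \<subseteq> E"
    using path[OF p(1)] path[OF q(1)] by (auto simp: graph_of_map_def[of D])
  show "E \<subseteq> graph_of_map D (restrict par D) \<union> path_edges p \<union> path_edges q"
  proof
    fix e assume "e \<in> E"
    then obtain x where x: "x \<in> V - {c}" "e = {x, par x}" by (auto simp: graph_of_map_def)
    consider "x \<in> D" | "x \<in> set p - {p ! a}" | "x \<in> set q - {q ! b}"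
      using x by (auto simp: D_def free_vertices_def)
    then show "e \<in> graph_of_map D (restrict par D) \<union> path_edges p \<union> path_edges q"
    proof cases
      case 1
      then show ?thesis using x by (auto simp: graph_of_map_def)
    next
      case 2
      then show ?thesis using x nonapex_parent(2)[OF p(2)] p(1) by (auto simp: is_path_def)
    next
      case 3
      then show ?thesis using x nonapex_parent(2)[OF q(2)] q(1) by (auto simp: is_path_def)
    qed
  qed
qed

text \<open>The parent of a non-apex vertex lies on the same path, so a common non-apex vertex would
  give two common vertices.\<close>

lemma nonapex_disjoint:
  assumes p: "is_path V E p" "apex p a" and q: "is_path V E q" "apex q b"
    and share: "card (set p \<inter> set q) \<le> 1"
  shows "(set p - {p ! a}) \<inter> (set q - {q ! b}) = {}"
proof (rule ccontr)
  assume "(set p - {p ! a}) \<inter> (set q - {q ! b}) \<noteq> {}"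
  then obtain x where x: "x \<in> set p - {p ! a}" "x \<in> set q - {q ! b}" by blast
  have V: "set p \<subseteq> V" "set q \<subseteq> V" using p q by (auto simp: is_path_def)
  have "par x \<noteq> x" using parent[of x] nonapex_parent(1)[OF p(2) V(1) x(1)] by auto
  moreover have "{x, par x} \<subseteq> set p \<inter> set q"
    using x nonapex_parent(3)[OF p(2) V(1) x(1)] nonapex_parent(3)[OF q(2) V(2) x(2)] by auto
  then have "card {x, par x} \<le> card (set p \<inter> set q)" by (intro card_mono) auto
  ultimately show False using share by auto
qed

text \<open>The conditions on \<open>i\<close> force every leaf next to \<open>p ! i\<close> to be a
  child off both paths. As \<open>i \<noteq> a\<close>, the parent is a path neighbour, and the
  margin of two positions at each end makes both path neighbours interior, hence not leaves. As
  \<open>p ! i\<close> is not on \<open>q\<close>, a child of it on \<open>q\<close> can only be the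
  apex of \<open>q\<close>, which has a child itself. Conversely, a vertex off the paths has no
  child among the non-apex path vertices, so it is a leaf if no free vertex is mapped to it.\<close>

lemma adjacent_to_leaf_iff:
  assumes p: "is_path V E p" "apex p a" and q: "is_path V E q" "apex q b" "length q \<ge> 2"
    and i: "2 \<le> i" "i + 2 < length p" "i \<noteq> a" "p ! i \<notin> set q"
  defines "D \<equiv> free_vertices V c p q a b"
  shows "adjacent_to_leaf E (p ! i) \<longleftrightarrow> has_leaf_preimage D (V - {c} - set p - set q) (restrict par D) (p ! i)"
    (is "_ \<longleftrightarrow> has_leaf_preimage D ?D0 ?g (p ! i)")
proof
  have V: "set p \<subseteq> V" "set q \<subseteq> V" and d: "distinct p" using p q by (auto simp: is_path_def)
  have D0: "?D0 \<subseteq> D" by (auto simp: D_def free_vertices_def)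
  have DV: "D \<subseteq> V - {c}" by (auto simp: D_def free_vertices_def)
  have nbr: "j = Suc i \<or> Suc j = i" if e: "{p ! j, par (p ! j)} \<in> path_edges p" "par (p ! j) = p ! i" "j < length p" for j
  proof -
    obtain k where "Suc k < length p" "{p ! j, p ! i} = {p ! k, p ! Suc k}"
      using e(1,2) by (auto simp: path_edges_def)
    then show ?thesis using d i e(3) by (auto simp: doubleton_eq_iff nth_eq_iff_index_eq)
  qed
  {
    assume "adjacent_to_leaf E (p ! i)"
    then obtain w where w: "{p ! i, w} \<in> E" "degree E w = 1"
      by (auto simp: adjacent_to_leaf_def neighbours_def)
    have x: "p ! i \<in> set p - {p ! a}" using i d p(2) by (auto simp: nth_eq_iff_index_eq apex_def)
    have "\<not> w = par (p ! i)"
    proof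
      assume eq: "w = par (p ! i)"
      have "w = p ! Suc i \<or> w = p ! (i - 1)"
        using p(2) i eq by (cases "i < a") (auto simp: apex_def)
      then show False using degree_interior_ne_1[OF p(1), of "Suc i"] degree_interior_ne_1[OF p(1), of "i - 1"] i w(2) by auto
    qed
    then have wV: "w \<in> V - {c}" "par w = p ! i" using w(1) by (auto simp: in_graph_of_map_iff)
    have childless: "par z \<noteq> w" if "z \<in> V - {c}" for z
      using degree_parent_ne_1[OF that] w(2) wV by auto
    have "w \<notin> set p"
    proof
      assume "w \<in> set p"
      then obtain j where j: "j < length p" "w = p ! j" by (auto simp: in_set_conv_nth)
      show False
      proof (cases "j = a")
        case True
        then show ?thesis using apex_has_child[OF p(2) V(1)] childless i j by auto
      next
        case False
        then have "w \<in> set p - {p ! a}" using j d p(2) by (auto simp: nth_eq_iff_index_eq apex_def)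
        then have "{p ! j, par (p ! j)} \<in> path_edges p" using nonapex_parent(2)[OF p(2) V(1)] j by auto
        then have "j = Suc i \<or> Suc j = i" using nbr wV j by auto
        then show False using degree_interior_ne_1[OF p(1), of j] i w(2) j by auto
      qed
    qed
    moreover have "w \<notin> set q"
    proof
      assume "w \<in> set q"
      then have "w = q ! b" using nonapex_parent(3)[OF q(2) V(2), of w] wV i by auto
      then show False using apex_has_child[OF q(2) V(2) q(3)] childless by auto
    qed
    ultimately have "w \<in> ?D0" using wV by auto
    moreover have "w \<notin> ?g ` D" using childless DV by auto
    ultimately show "has_leaf_preimage D ?D0 ?g (p ! i)"
      unfolding has_leaf_preimage_def using wV D0 by (intro bexI[of _ w]) auto
  }
  {
    assume "has_leaf_preimage D ?D0 ?g (p ! i)"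
    then obtain w where w: "w \<in> ?D0" "?g w = p ! i" "w \<notin> ?g ` D" by (auto simp: has_leaf_preimage_def)
    then have pw: "par w = p ! i" using D0 by auto
    have "z = par w" if "{w, z} \<in> E" for z
    proof (rule ccontr)
      assume "z \<noteq> par w"
      then have z: "z \<in> V - {c}" "par z = w" using that by (auto simp: in_graph_of_map_iff)
      then have "z \<notin> D" using w(3) by auto
      then have "z \<in> set p - {p ! a} \<or> z \<in> set q - {q ! b}" using z by (auto simp: D_def free_vertices_def)
      then have "w \<in> set p \<or> w \<in> set q" using nonapex_parent(3)[OF p(2) V(1)] nonapex_parent(3)[OF q(2) V(2)] z by blast
      then show False using w by auto
    qed
    moreover have "{w, par w} \<in> E" using w by (auto simp: in_graph_of_map_iff)
    ultimately have "neighbours E w = {par w}" unfolding neighbours_def by blast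
    then have "degree E w = 1" by (simp add: degree_def)
    moreover have "w \<in> neighbours E (p ! i)" using w pw by (auto simp: neighbours_def in_graph_of_map_iff)
    ultimately show "adjacent_to_leaf E (p ! i)" by (auto simp: adjacent_to_leaf_def)
  }
qed

end

section \<open>Encoding trees with a bad pair of paths\<close>

text \<open>The positions at which \<open>adjacent_to_leaf_iff\<close> applies to both paths, for
  paths with \<open>r\<close> edges.\<close>

definition matched_indices :: "nat \<Rightarrow> 'a list \<Rightarrow> 'a list \<Rightarrow> nat \<Rightarrow> nat \<Rightarrow> nat set" where
  "matched_indices r p q a b = {2..r - 2} - {a, b} - {i. i \<le> r \<and> p ! i \<in> set q} - {i. i \<le> r \<and> q ! i \<in> set p}"

definition symmetric_maps :: "'a set \<Rightarrow> 'a \<Rightarrow> nat \<Rightarrow> 'a list \<Rightarrow> 'a list \<Rightarrow> nat \<Rightarrow> nat \<Rightarrow> ('a \<Rightarrow> 'a) set" where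
  "symmetric_maps V c r p q a b = (let D = free_vertices V c p q a b; D0 = V - {c} - set p - set q in
     {g \<in> D \<rightarrow>\<^sub>E V. \<forall>i\<in>matched_indices r p q a b. has_leaf_preimage D D0 g (p ! i) \<longleftrightarrow> has_leaf_preimage D D0 g (q ! i)})"

text \<open>The conditions mention no edges, so codes are counted before any tree is chosen; the
  rest of the tree enters through the map \<open>g\<close> alone.\<close>

definition path_pair_codes :: "'a set \<Rightarrow> 'a \<Rightarrow> nat \<Rightarrow> ('a list \<times> 'a list \<times> nat \<times> nat) set" where
  "path_pair_codes V c r = {(p, q, a, b). set p \<subseteq> V \<and> length p = Suc r \<and> distinct p \<and> set q \<subseteq> V \<and> length q = Suc r \<and> distinct q
      \<and> a \<le> r \<and> b \<le> r \<and> card (set p \<inter> set q) \<le> 1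
      \<and> c \<notin> set p - {p ! a} \<and> c \<notin> set q - {q ! b} \<and> (set p - {p ! a}) \<inter> (set q - {q ! b}) = {}}"

lemma path_pair_codes_subset:
  "path_pair_codes V c r \<subseteq> {p. set p \<subseteq> V \<and> length p = Suc r} \<times> {p. set p \<subseteq> V \<and> length p = Suc r} \<times> {..r} \<times> {..r}"
  by (auto simp: path_pair_codes_def)

lemma finite_path_pair_codes: "finite V \<Longrightarrow> finite (path_pair_codes V c r)"
  by (rule finite_subset[OF path_pair_codes_subset]) (intro finite_cartesian_product finite_lists_length_eq, auto)

lemma card_path_pair_codes_le:
  assumes "finite V"
  shows "card (path_pair_codes V c r) \<le> card V ^ (2 * r + 2) * (r + 1)\<^sup>2"
proof -
  have "card (path_pair_codes V c r) \<le> card ({p. set p \<subseteq> V \<and> length p = Suc r} \<times> {p. set p \<subseteq> V \<and> length p = Suc r} \<times> {..r} \<times> {..r})"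
    using assms by (intro card_mono[OF _ path_pair_codes_subset] finite_cartesian_product finite_lists_length_eq) auto
  also have "\<dots> = card V ^ (Suc r + Suc r) * (r + 1)\<^sup>2"
    using assms by (simp only: card_cartesian_product card_lists_length_eq card_atMost power_add power2_eq_square mult_ac Suc_eq_plus1)
  finally show ?thesis by (simp add: mult_2)
qed

lemma card_shared_indices_le:
  assumes "distinct p" "length p = Suc r" "card (set p \<inter> set q) \<le> 1"
  shows "card {i. i \<le> r \<and> p ! i \<in> set q} \<le> 1"
proof -
  have "card {i. i \<le> r \<and> p ! i \<in> set q} \<le> card (set p \<inter> set q)"
    using assms by (intro card_inj_on_le[of "(!) p"]) (auto simp: inj_on_def nth_eq_iff_index_eq less_Suc_eq_le)
  then show ?thesis using assms(3) by linarith
qed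

text \<open>Of the \<open>r - 3\<close> positions in \<open>{2..r - 2}\<close>, the apexes remove at
  most two, and the possible common vertex at most one for each path.\<close>

lemma card_matched_indices_ge:
  assumes "(p, q, a, b) \<in> path_pair_codes V c r"
  shows "r - 7 \<le> card (matched_indices r p q a b)"
proof -
  let ?P = "{i. i \<le> r \<and> p ! i \<in> set q}" and ?Q = "{i. i \<le> r \<and> q ! i \<in> set p}"
  have P: "card ?P \<le> 1" using assms by (intro card_shared_indices_le) (auto simp: path_pair_codes_def)
  have Q: "card ?Q \<le> 1" using assms by (intro card_shared_indices_le) (auto simp: path_pair_codes_def Int_commute)
  have fin: "finite ?P" "finite ?Q" by (rule finite_subset[of _ "{..r}"]; auto)+
  have "card {2..r - 2} - card {a, b} \<le> card ({2..r - 2} - {a, b})" by (rule diff_card_le_card_Diff) auto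
  moreover have "card {a, b} \<le> 2" by (simp add: card_insert_if)
  moreover have "card ({2..r - 2} - {a, b}) - card ?P \<le> card ({2..r - 2} - {a, b} - ?P)"
    by (rule diff_card_le_card_Diff[OF fin(1)])
  moreover have "card ({2..r - 2} - {a, b} - ?P) - card ?Q \<le> card (matched_indices r p q a b)"
    unfolding matched_indices_def by (rule diff_card_le_card_Diff[OF fin(2)])
  moreover have "card {2..r - 2} = r - 3" by simp
  ultimately show ?thesis using P Q by linarith
qed

lemma card_free_vertices:
  assumes "finite V" "c \<in> V" "(p, q, a, b) \<in> path_pair_codes V c r"
  shows "card (free_vertices V c p q a b) = card V - 1 - 2 * r"
proof -
  have *: "card (set p - {p ! a}) = r" "card (set q - {q ! b}) = r"
    using assms(3) by (auto simp: path_pair_codes_def card_Diff_singleton distinct_card)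
  have "free_vertices V c p q a b = V - ({c} \<union> ((set p - {p ! a}) \<union> (set q - {q ! b})))"
    by (auto simp: free_vertices_def)
  also have "card \<dots> = card V - card ({c} \<union> ((set p - {p ! a}) \<union> (set q - {q ! b})))"
    using assms by (intro card_Diff_subset) (auto simp: path_pair_codes_def)
  also have "card ({c} \<union> ((set p - {p ! a}) \<union> (set q - {q ! b}))) = card {c} + card ((set p - {p ! a}) \<union> (set q - {q ! b}))"
    using assms by (intro card_Un_disjoint) (auto simp: path_pair_codes_def)
  also have "card ((set p - {p ! a}) \<union> (set q - {q ! b})) = 2 * r"
    using assms * by (subst card_Un_disjoint) (auto simp: path_pair_codes_def)
  finally show ?thesis by simp
qed

lemma card_symmetric_maps_code_le:
  assumes V: "finite V" "c \<in> V" and code: "(p, q, a, b) \<in> path_pair_codes V c r"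
  shows "real (card (symmetric_maps V c r p q a b)) * (1 - exp (- 1))\<^sup>2
     \<le> fact (card V - 1 - 2 * r) * exp (real (card V)) * match_rate ^ (r - 7)"
proof -
  let ?D = "free_vertices V c p q a b" and ?O = "V - {c} - set p - set q" and ?I = "matched_indices r p q a b"
  let ?\<kappa> = "1 - exp (- 1) :: real"
  have d: "distinct p" "distinct q" "length p = Suc r" "length q = Suc r" "set p \<subseteq> V" "set q \<subseteq> V" "a \<le> r" "b \<le> r"
    using code by (auto simp: path_pair_codes_def)
  have I: "i \<le> r" "i \<noteq> a" "i \<noteq> b" "p ! i \<notin> set q" "q ! i \<notin> set p" if "i \<in> ?I" for i
    using that by (auto simp: matched_indices_def)
  have fin: "finite ?D" "finite ?O" using V by (auto simp: free_vertices_def)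
  have \<kappa>: "0 < ?\<kappa>" "?\<kappa> < 1" by auto
  \<comment> \<open>The only path vertices that can be free are the two apexes, so the loss in
    \<open>card_symmetric_maps_le\<close> is at most two factors
    \<open>1 - exp (- 1)\<close>.\<close>
  have "?D - ?O \<subseteq> {p ! a, q ! b}" by (auto simp: free_vertices_def)
  then have "card (?D - ?O) \<le> card {p ! a, q ! b}" by (intro card_mono) auto
  also have "\<dots> \<le> 2" by (simp add: card_insert_if)
  finally have \<kappa>2: "?\<kappa>\<^sup>2 \<le> ?\<kappa> ^ card (?D - ?O)" using \<kappa> by (intro power_decreasing) auto
  have "real (card (symmetric_maps V c r p q a b)) * ?\<kappa>\<^sup>2 \<le> real (card (symmetric_maps V c r p q a b)) * ?\<kappa> ^ card (?D - ?O)"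
    using \<kappa>2 by (intro mult_left_mono) auto
  also have "\<dots> \<le> fact (card ?D) * exp (real (card V)) * match_rate ^ card ?I"
    unfolding symmetric_maps_def Let_def
  proof (rule card_symmetric_maps_le)
    show "finite V" by fact
    show "?D \<subseteq> V" "?O \<subseteq> ?D" by (auto simp: free_vertices_def)
    show "finite ?I" by (simp add: matched_indices_def)
    show "inj_on ((!) p) ?I" "inj_on ((!) q) ?I"
      using d I(1) by (auto simp: inj_on_def nth_eq_iff_index_eq less_Suc_eq_le)
    show "(!) p ` ?I \<inter> (!) q ` ?I = {}"
    proof -
      have "p ! i \<noteq> q ! j" if "i \<in> ?I" "j \<in> ?I" for i j
        using I(1)[OF that(2)] I(4)[OF that(1)] d by (metis less_Suc_eq_le nth_mem)
      then show ?thesis by blast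
    qed
    have "p ! i \<in> V - ?D" "q ! i \<in> V - ?D" if "i \<in> ?I" for i
    proof -
      have "p ! i \<in> set p" "q ! i \<in> set q" using I(1)[OF that] d by auto
      moreover have "p ! i \<noteq> p ! a" "q ! i \<noteq> q ! b"
        using I(1-3)[OF that] d by (auto simp: nth_eq_iff_index_eq less_Suc_eq_le)
      ultimately show "p ! i \<in> V - ?D" "q ! i \<in> V - ?D" using d by (auto simp: free_vertices_def)
    qed
    then show "(!) p ` ?I \<union> (!) q ` ?I \<subseteq> V - ?D" by blast
  qed
  also have "\<dots> \<le> fact (card ?D) * exp (real (card V)) * match_rate ^ (r - 7)"
    using match_rate_bounds order_trans[OF match_rate_bounds(2), of 1] card_matched_indices_ge[OF code] by (intro mult_left_mono power_decreasing) auto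
  finally show ?thesis by (simp add: card_free_vertices[OF V code])
qed

text \<open>Every bad tree is decoded from some code and some map. A union bound follows, so it does
  not matter how many codes yield the same tree.\<close>

lemma bad_tree_encoding:
  assumes tree: "is_tree V T" and c: "c \<in> V" and r: "r \<ge> 1" and bad: "\<not> checks_distinct r V T"
  shows "\<exists>(p, q, a, b)\<in>path_pair_codes V c r. \<exists>g\<in>symmetric_maps V c r p q a b.
    T = graph_of_map (free_vertices V c p q a b) g \<union> path_edges p \<union> path_edges q"
proof -
  obtain par and rk :: "'a \<Rightarrow> nat"
    where par: "\<And>x. x \<in> V - {c} \<Longrightarrow> par x \<in> V \<and> rk (par x) < rk x" and T: "T = graph_of_map (V - {c}) par"
    using tree_has_parent_map[OF tree c] by blast
  interpret rooted_tree V c par rk by unfold_locales (rule par)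
  obtain p q where p: "is_path V E p" and q: "is_path V E q"
    and len: "path_length p = r" "path_length q = r" and share: "card (set p \<inter> set q) \<le> 1"
    and check: "path_check E p = path_check E q"
    using bad unfolding checks_distinct_def T by blast
  obtain a where a: "apex p a" using apex_exists[OF p] .
  obtain b where b: "apex q b" using apex_exists[OF q] .
  have len': "length p = Suc r" "length q = Suc r" using len r by (auto simp: path_length_def)
  let ?D = "free_vertices V c p q a b" and ?I = "matched_indices r p q a b"
  let ?g = "restrict par ?D"
  have V: "set p \<subseteq> V" "set q \<subseteq> V" using p q by (auto simp: is_path_def)
  have "(p, q, a, b) \<in> path_pair_codes V c r"
    using p q len' share a b nonapex_disjoint[OF p a q b share] nonapex_parent(1)[OF a V(1)] nonapex_parent(1)[OF b V(2)]
    by (auto simp: path_pair_codes_def is_path_def apex_def less_Suc_eq_le)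
  moreover have "?g \<in> symmetric_maps V c r p q a b"
  proof -
    have "?g \<in> ?D \<rightarrow>\<^sub>E V" using par by (auto simp: free_vertices_def)
    moreover have "has_leaf_preimage ?D (V - {c} - set p - set q) ?g (p ! i) \<longleftrightarrow> has_leaf_preimage ?D (V - {c} - set p - set q) ?g (q ! i)"
      if "i \<in> ?I" for i
    proof -
      have i: "2 \<le> i" "i + 2 < Suc r" "i \<noteq> a" "i \<noteq> b" "p ! i \<notin> set q" "q ! i \<notin> set p"
        using that by (auto simp: matched_indices_def)
      have l2: "2 \<le> length p" "2 \<le> length q" using i len' by auto
      have "path_check E p ! i = path_check E q ! i" by (simp add: check)
      then have "adjacent_to_leaf E (p ! i) \<longleftrightarrow> adjacent_to_leaf E (q ! i)"
        using i len' by (simp add: path_check_def split: if_splits)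
      moreover have "adjacent_to_leaf E (p ! i) \<longleftrightarrow> has_leaf_preimage ?D (V - {c} - set p - set q) ?g (p ! i)"
        using i len' by (intro adjacent_to_leaf_iff[OF p a q b l2(2)]) auto
      moreover have "adjacent_to_leaf E (q ! i) \<longleftrightarrow> has_leaf_preimage ?D (V - {c} - set p - set q) ?g (q ! i)"
      proof -
        have "V - {c} - set p - set q = V - {c} - set q - set p" by auto
        then show ?thesis
          using i len' adjacent_to_leaf_iff[OF q b p a l2(1), of i] by (simp add: free_vertices_commute)
      qed
      ultimately show ?thesis by blast
    qed
    ultimately show ?thesis unfolding symmetric_maps_def Let_def by blast
  qed
  moreover have "T = graph_of_map ?D ?g \<union> path_edges p \<union> path_edges q"
    unfolding T by (rule edges_eq[OF p a q b])
  ultimately show ?thesis by blast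
qed

lemma card_bad_trees_le:
  assumes n: "n \<ge> 1" and r: "r \<ge> 1"
  shows "real (card {T \<in> labelled_trees n. \<not> checks_distinct r {1..n} T}) * (1 - exp (- 1))\<^sup>2
     \<le> real n ^ (2 * r + 2) * (real r + 1)\<^sup>2 * (fact (n - 1 - 2 * r) * exp (real n) * match_rate ^ (r - 7))"
proof -
  let ?V = "{1..n}" and ?\<kappa> = "1 - exp (- 1) :: real"
  let ?C = "path_pair_codes ?V 1 r"
  let ?G = "\<lambda>(p, q, a, b). (\<lambda>g. graph_of_map (free_vertices ?V 1 p q a b) g \<union> path_edges p \<union> path_edges q) ` symmetric_maps ?V 1 r p q a b"
  let ?B = "fact (n - 1 - 2 * r) * exp (real n) * match_rate ^ (r - 7)"
  have fin: "finite (symmetric_maps ?V 1 r p q a b)" for p q a b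
    unfolding symmetric_maps_def Let_def
    by (rule finite_subset[OF _ finite_PiE[of "free_vertices ?V 1 p q a b" "\<lambda>_. ?V"]]) (auto simp: free_vertices_def)
  have "{T \<in> labelled_trees n. \<not> checks_distinct r ?V T} \<subseteq> (\<Union>t\<in>?C. ?G t)"
  proof
    fix T assume "T \<in> {T \<in> labelled_trees n. \<not> checks_distinct r ?V T}"
    then show "T \<in> (\<Union>t\<in>?C. ?G t)"
      using bad_tree_encoding[of ?V T 1 r] n r by (fastforce simp: labelled_trees_def)
  qed
  then have "card {T \<in> labelled_trees n. \<not> checks_distinct r ?V T} \<le> card (\<Union>t\<in>?C. ?G t)"
    using fin by (intro card_mono finite_UN_I finite_path_pair_codes) auto
  also have "\<dots> \<le> (\<Sum>t\<in>?C. card (?G t))" by (intro card_UN_le finite_path_pair_codes) auto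
  finally have "real (card {T \<in> labelled_trees n. \<not> checks_distinct r ?V T}) * ?\<kappa>\<^sup>2 \<le> real (\<Sum>t\<in>?C. card (?G t)) * ?\<kappa>\<^sup>2"
    by (intro mult_right_mono of_nat_mono) auto
  also have "\<dots> = (\<Sum>t\<in>?C. real (card (?G t)) * ?\<kappa>\<^sup>2)" by (simp add: sum_distrib_right)
  also have "\<dots> \<le> (\<Sum>t\<in>?C. ?B)"
  proof (rule sum_mono)
    fix t assume t: "t \<in> ?C"
    obtain p q a b where pq: "t = (p, q, a, b)" by (cases t) auto
    have "real (card (?G t)) * ?\<kappa>\<^sup>2 \<le> real (card (symmetric_maps ?V 1 r p q a b)) * ?\<kappa>\<^sup>2"
      using card_image_le[OF fin] by (intro mult_right_mono) (auto simp: pq)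
    also have "\<dots> \<le> ?B" using card_symmetric_maps_code_le[of ?V 1 p q a b r] t n by (simp add: pq)
    finally show "real (card (?G t)) * ?\<kappa>\<^sup>2 \<le> ?B" .
  qed
  also have "\<dots> = real (card ?C) * ?B" by simp
  also have "\<dots> \<le> real (n ^ (2 * r + 2) * (r + 1)\<^sup>2) * ?B"
    using card_path_pair_codes_le[of ?V 1 r] match_rate_bounds
    by (intro mult_right_mono) (auto simp del: of_nat_mult of_nat_power)
  finally show ?thesis by (simp add: add.commute)
qed

section \<open>Asymptotics\<close>

text \<open>The constant \<open>exp 1\<close> gives equality at \<open>d = 1\<close>. The induction
  step amounts to \<open>(1 + 1 / d)\<close> raised to \<open>d + 1 / 2\<close> being at least
  \<open>exp 1\<close>, which follows from
  \<open>2 * (y - x) / (x + y) \<le> ln y - ln x\<close>.\<close>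

lemma fact_le_Stirling:
  assumes "d \<ge> 1"
  shows "fact d \<le> exp 1 * sqrt (real d) * (real d / exp 1) ^ d"
  using assms
proof (induction d rule: dec_induct)
  case base
  show ?case by simp
next
  case (step d)
  have d: "real d > 0" using step by simp
  have "1 \<le> (real d + 1 / 2) * (ln (real d + 1) - ln (real d))"
  proof -
    have "2 * (real d + 1 - real d) / (real d + (real d + 1)) \<le> ln (real d + 1) - ln (real d)"
      using d by (intro ln_inverse_approx_ge) auto
    then show ?thesis using d by (simp add: field_simps)
  qed
  then have "exp (1 + (real d + 1 / 2) * ln (real d)) \<le> exp ((real d + 1 / 2) * ln (real d + 1))"
    by (simp add: algebra_simps)
  moreover have "exp ((real d + 1 / 2) * ln x) = x ^ d * sqrt x" if "x > 0" for x :: real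
    using that by (simp add: distrib_right exp_add exp_of_nat_mult flip: powr_half_sqrt) (simp add: powr_def)
  ultimately have *: "exp 1 * (real d ^ d * sqrt (real d)) \<le> (real d + 1) ^ d * sqrt (real d + 1)"
    using d by (simp add: exp_add)
  have "fact (Suc d) = (real d + 1) * fact d" by (simp add: add.commute)
  also have "\<dots> \<le> (real d + 1) * (exp 1 * sqrt (real d) * (real d / exp 1) ^ d)"
    using step.IH by (intro mult_left_mono) auto
  also have "\<dots> = (real d + 1) * (exp 1 * (real d ^ d * sqrt (real d))) / exp 1 ^ d"
    by (simp add: power_divide field_simps)
  also have "\<dots> \<le> (real d + 1) * ((real d + 1) ^ d * sqrt (real d + 1)) / exp 1 ^ d"
    using * by (intro divide_right_mono mult_left_mono) auto
  also have "\<dots> = exp 1 * sqrt (real (Suc d)) * (real (Suc d) / exp 1) ^ Suc d"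
    by (simp add: power_divide field_simps)
  finally show ?case .
qed

text \<open>After Stirling's bound there remains \<open>exp k * (d / n) ^ d\<close> with
  \<open>d = n - k\<close>. Since \<open>1 - k / n \<le> exp (- k / n)\<close>, the exponent
  \<open>k - d * k / n = k\<^sup>2 / n\<close> survives.\<close>

lemma fact_exp_div_power_le:
  assumes "d \<ge> 1" "n = d + k"
  shows "fact d * exp (real n) / real n ^ d \<le> exp 1 * sqrt (real n) * exp ((real k)\<^sup>2 / real n)"
proof -
  have n: "real n > 0" "real d \<le> real n" using assms by auto
  have "fact d * exp (real n) / real n ^ d \<le> exp 1 * sqrt (real d) * (real d / exp 1) ^ d * exp (real n) / real n ^ d"
    using fact_le_Stirling[OF assms(1)] by (intro divide_right_mono mult_right_mono) auto
  also have "\<dots> = exp 1 * sqrt (real d) * (exp (real k) * (real d / real n) ^ d)"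
    using assms by (simp add: power_divide exp_add exp_of_nat_mult[of _ 1, simplified] field_simps)
  also have "\<dots> \<le> exp 1 * sqrt (real n) * (exp (real k) * exp (- (real k / real n)) ^ d)"
  proof -
    have "real d / real n = 1 + - (real k / real n)" using assms n by (simp add: field_simps)
    also have "\<dots> \<le> exp (- (real k / real n))" by (rule exp_ge_add_one_self)
    finally show ?thesis using n by (intro mult_mono power_mono) auto
  qed
  also have "exp (real k) * exp (- (real k / real n)) ^ d = exp ((real k)\<^sup>2 / real n)"
  proof -
    have "exp (real k) * exp (- (real k / real n)) ^ d = exp (real k + real d * (- (real k / real n)))"
      unfolding exp_add exp_of_nat_mult ..
    also have "real k + real d * (- (real k / real n)) = (real k)\<^sup>2 / real n"
      using assms n by (simp add: field_simps power2_eq_square)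
    finally show ?thesis .
  qed
  finally show ?thesis .
qed

text \<open>Here \<open>k = 2 * r + 1\<close>, and the hypothesis on \<open>n\<close> bounds
  \<open>exp (k\<^sup>2 / n)\<close> by \<open>exp 1\<close>; Stirling's constant supplies the other
  factor of \<open>exp 2\<close>.\<close>

lemma bad_fraction_le:
  assumes r: "r \<ge> 7" and n: "(2 * r + 1)\<^sup>2 \<le> n"
  shows "real (card {T \<in> labelled_trees n. \<not> checks_distinct r {1..n} T}) / real (card (labelled_trees n)) * (1 - exp (- 1))\<^sup>2
     \<le> exp 2 * (real n ^ 3 * sqrt (real n) * (real r + 1)\<^sup>2 * exp (- 51 / 100) ^ (r - 7))"
proof -
  define d where "d = n - 1 - 2 * r"
  let ?\<kappa> = "1 - exp (- 1) :: real"
  let ?bad = "real (card {T \<in> labelled_trees n. \<not> checks_distinct r {1..n} T})"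
  have "2 * r + 1 < (2 * r + 1)\<^sup>2" using r by (simp add: power2_eq_square)
  then have d: "d \<ge> 1" "n = d + (2 * r + 1)" using n by (auto simp: d_def)
  have n0: "n \<ge> 1" "real n > 0" using d by auto
  have trees: "real n ^ (n - 1) \<le> real n * real (card (labelled_trees n))"
    using card_labelled_trees_ge[OF n0(1)] by (metis of_nat_le_iff of_nat_mult of_nat_power)
  have pos: "real (card (labelled_trees n)) > 0"
    using labelled_trees_nonempty[OF n0(1)] finite_labelled_trees[of n] by (simp add: card_gt_0_iff)
  have rate: "match_rate ^ (r - 7) \<le> exp (- 51 / 100) ^ (r - 7)"
    using match_rate_bounds by (intro power_mono) auto
  have "?bad / real (card (labelled_trees n)) * ?\<kappa>\<^sup>2 = ?bad * ?\<kappa>\<^sup>2 / real (card (labelled_trees n))" by simp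
  also have "\<dots> \<le> ?bad * ?\<kappa>\<^sup>2 / (real n ^ (n - 1) / real n)"
    using trees pos n0 by (intro divide_left_mono) (auto simp: field_simps)
  also have "\<dots> \<le> (real n ^ (2 * r + 2) * (real r + 1)\<^sup>2 * (fact d * exp (real n) * match_rate ^ (r - 7))) / (real n ^ (n - 1) / real n)"
    unfolding d_def using r n0 by (intro divide_right_mono card_bad_trees_le) auto
  also have "\<dots> = real n ^ 3 * (real r + 1)\<^sup>2 * match_rate ^ (r - 7) * (fact d * exp (real n) / real n ^ d)"
  proof -
    \<comment> \<open>As \<open>n - 1 = d + 2 * r\<close>, the power \<open>2 * r\<close> cancels
      against the choice of the paths and leaves \<open>n ^ 3 / n ^ d\<close>.\<close>
    have "real n ^ (n - 1) = real n ^ d * real n ^ (2 * r)" using d by (simp flip: power_add)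
    moreover have "real n ^ (2 * r + 2) = real n ^ (2 * r) * real n ^ 2" by (rule power_add)
    ultimately show ?thesis using n0 by (simp add: divide_simps power2_eq_square power3_eq_cube)
  qed
  also have "\<dots> \<le> real n ^ 3 * (real r + 1)\<^sup>2 * exp (- 51 / 100) ^ (r - 7) * (exp 1 * sqrt (real n) * exp ((real (2 * r + 1))\<^sup>2 / real n))"
    using fact_exp_div_power_le[OF d] rate match_rate_bounds by (intro mult_mono) auto
  also have "\<dots> \<le> real n ^ 3 * (real r + 1)\<^sup>2 * exp (- 51 / 100) ^ (r - 7) * (exp 1 * sqrt (real n) * exp 1)"
  proof -
    have "(real (2 * r + 1))\<^sup>2 \<le> real n" using n by (metis of_nat_le_iff of_nat_power)
    then have "(real (2 * r + 1))\<^sup>2 / real n \<le> 1" using n0 by simp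
    then show ?thesis by (intro mult_left_mono) auto
  qed
  also have "\<dots> = exp 2 * (real n ^ 3 * sqrt (real n) * (real r + 1)\<^sup>2 * exp (- 51 / 100) ^ (r - 7))"
    by (simp add: mult_ac flip: exp_add)
  finally show ?thesis .
qed

text \<open>The bound has order \<open>n\<close> to the power \<open>3.5 - 3.57\<close>, times a
  squared logarithm, since \<open>7 * 51 / 100 = 3.57\<close>.\<close>

lemma bad_fraction_tendsto_0:
  "(\<lambda>n. real (card {T \<in> labelled_trees n. \<not> checks_distinct (nat \<lceil>7 * ln (real n)\<rceil>) {1..n} T}) / real (card (labelled_trees n))) \<longlonglongrightarrow> 0"
proof -
  define r where "r = (\<lambda>n::nat. nat \<lceil>7 * ln (real n)\<rceil>)"
  define \<rho> where "\<rho> = (\<lambda>n. real (card {T \<in> labelled_trees n. \<not> checks_distinct (r n) {1..n} T}) / real (card (labelled_trees n)))"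
  define C where "C = exp 2 / (1 - exp (- 1 :: real))\<^sup>2"
  define B where "B = (\<lambda>n::nat. C * (real n ^ 3 * sqrt (real n) * (7 * ln (real n) + 2)\<^sup>2 * exp (- 51 / 100 * (7 * ln (real n) - 7))))"
  \<comment> \<open>These two conditions yield the hypotheses of \<open>bad_fraction_le\<close>:
    rounding up gives \<open>r n \<le> 7 * ln n + 1\<close>, hence
    \<open>2 * r n + 1 \<le> 14 * ln n + 3\<close>.\<close>
  have ev1: "\<forall>\<^sub>F n::nat in sequentially. 8 \<le> 7 * ln (real n)" by real_asymp
  have ev2: "\<forall>\<^sub>F n::nat in sequentially. (14 * ln (real n) + 3)\<^sup>2 \<le> real n" by real_asymp
  have "\<forall>\<^sub>F n in sequentially. \<rho> n \<le> B n"
    using ev1 ev2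
  proof eventually_elim
    case (elim n)
    have r: "7 * ln (real n) \<le> real (r n)" "real (r n) \<le> 7 * ln (real n) + 1"
      using elim(1) by (auto simp: r_def intro: of_nat_ceiling)
    have r7: "r n \<ge> 7" using r elim by linarith
    have "(2 * real (r n) + 1)\<^sup>2 \<le> (14 * ln (real n) + 3)\<^sup>2" using r by (intro power_mono) auto
    also have "\<dots> \<le> real n" by (rule elim)
    finally have "real ((2 * r n + 1)\<^sup>2) \<le> real n" by (simp add: add.commute)
    then have rn: "(2 * r n + 1)\<^sup>2 \<le> n" by (simp only: of_nat_le_iff)
    have "\<rho> n * (1 - exp (- 1))\<^sup>2 \<le> exp 2 * (real n ^ 3 * sqrt (real n) * (real (r n) + 1)\<^sup>2 * exp (- 51 / 100) ^ (r n - 7))"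
      unfolding \<rho>_def by (rule bad_fraction_le[OF r7 rn])
    also have "\<dots> \<le> exp 2 * (real n ^ 3 * sqrt (real n) * (7 * ln (real n) + 2)\<^sup>2 * exp (- 51 / 100 * (7 * ln (real n) - 7)))"
    proof -
      have "exp (- 51 / 100 :: real) ^ (r n - 7) = exp (- 51 / 100 * (real (r n) - 7))"
        using r7 by (simp add: of_nat_diff mult.commute flip: exp_of_nat_mult)
      also have "\<dots> \<le> exp (- 51 / 100 * (7 * ln (real n) - 7))"
        using r by simp
      finally show ?thesis using r elim by (intro mult_mono power_mono) auto
    qed
    finally show "\<rho> n \<le> B n" by (simp add: B_def C_def field_simps)
  qed
  moreover have "B \<longlonglongrightarrow> 0"
    unfolding B_def by (rule tendsto_mult_right_zero) real_asymp
  moreover have "\<forall>\<^sub>F n in sequentially. 0 \<le> \<rho> n" by (simp add: \<rho>_def)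
  ultimately have "\<rho> \<longlonglongrightarrow> 0" using tendsto_sandwich[OF _ _ tendsto_const] by blast
  then show ?thesis by (simp add: \<rho>_def r_def)
qed

theorem theorem6:
  shows "(\<lambda>n::nat. measure_pmf.prob (pmf_of_set (labelled_trees n))
            {E. checks_distinct (nat \<lceil>7 * ln (real n)\<rceil>) {1..n} E}) \<longlonglongrightarrow> 1"
proof -
  let ?good = "\<lambda>n. {E. checks_distinct (nat \<lceil>7 * ln (real n)\<rceil>) {1..n} E}"
  let ?\<rho> = "\<lambda>n. real (card {T \<in> labelled_trees n. \<not> checks_distinct (nat \<lceil>7 * ln (real n)\<rceil>) {1..n} T}) / real (card (labelled_trees n))"
  have "measure_pmf.prob (pmf_of_set (labelled_trees n)) (?good n) = 1 - ?\<rho> n" if "n \<ge> 1" for n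
  proof -
    note T = labelled_trees_nonempty[OF that] finite_labelled_trees[of n]
    have "measure_pmf.prob (pmf_of_set (labelled_trees n)) (- ?good n) = ?\<rho> n"
      by (simp add: measure_pmf_of_set[OF T] Int_def)
    then show ?thesis using measure_pmf.prob_compl[of "?good n" "pmf_of_set (labelled_trees n)"]
      by (simp add: Compl_eq_Diff_UNIV)
  qed
  \<comment> \<open>There is no tree on the empty vertex set, so the uniform distribution is
    meaningful from \<open>n = 1\<close> on.\<close>
  then have "\<forall>\<^sub>F n in sequentially. 1 - ?\<rho> n = measure_pmf.prob (pmf_of_set (labelled_trees n)) (?good n)"
    by (intro eventually_sequentiallyI[of 1]) simp
  moreover have "(\<lambda>n. 1 - ?\<rho> n) \<longlonglongrightarrow> 1 - 0"
    by (intro tendsto_diff tendsto_const bad_fraction_tendsto_0)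
  ultimately show ?thesis using Lim_transform_eventually by fastforce
qed

end
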